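(* $RC\,INS_2^{0,0}DEL_1^{1,0}=RE$. That is, a language is recursively enumerable if and only if it is generated by some random context insertion-deletion system with insertion and deletion rules of size $(2,0,0;1,1,0)$.
   Context: $\lambda$ denotes the empty string and $RE$ the family of recursively enumerable languages. An insertion rule $(u,\alpha,v)_{ins}$ and a deletion rule $(u,\alpha,v)_{del}$ over an alphabet $V$ are given by strings $u,\alpha,v\in V^*$ with $\alpha\neq\lambda$. For $x,y\in V^*$: $x\Rightarrow_{ins}y$ via $(u,\alpha,v)_{ins}$ if $x=x_1uvx_2$, $y=x_1u\alpha vx_2$ for some $x_1,x_2\in V^*$; $x\Rightarrow_{del}y$ via $(u,\alpha,v)_{del}$ if $x=x_1u\alpha vx_2$, $y=x_1uvx_2$ for some $x_1,x_2\in V^*$. A random context insertion-deletion system is a construct $\gamma=(V,T,A,R)$ where $V$ is a finite alphabet, $T\subseteq V$ is the terminal alphabet, $A\subseteq V^*$ is a finite set of axioms, and $R$ is a finite set of rules of the form $r=\bigl((a,b,c)_t,P,Q\bigr)$, where $t\in\{ins,del\}$, $(a,b,c)_t$ is an insertion rule if $t=ins$ and a deletion rule if $t=del$, and $P,Q\subseteq V$ are sets of letters (the permitting and forbidding conditions; either may be empty). For such a rule $r$, a transition $w\Longrightarrow_r w'$ between strings $w,w'\in V^*$ is performed if $w\Rightarrow_t w'$ via $(a,b,c)_t$, every letter of $P$ occurs in $w$, and no letter of $Q$ occurs in $w$. Let $\Longrightarrow^*$ be the reflexive and transitive closure of the union of the relations $\Longrightarrow_r$, $r\in R$. The generated language is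 $L(\gamma)=\{w\in T^*\mid x\Longrightarrow^* w\text{ for some }x\in A\}$. The system has rules of size $(n,m,m';p,q,q')$ if every insertion rule $(u,\alpha,v)_{ins}$ in it satisfies $|\alpha|\le n$, $|u|\le m$, $|v|\le m'$ and every deletion rule $(u,\alpha,v)_{del}$ in it satisfies $|\alpha|\le p$, $|u|\le q$, $|v|\le q'$. $RC\,INS_n^{m,m'}DEL_p^{q,q'}$ denotes the family of languages generated by random context insertion-deletion systems with rules of size $(n,m,m';p,q,q')$. *)

theory Defs
  imports "HOL-Library.Infinite_Typeclass"
begin

text \<open>
  Symbols are taken from an arbitrary infinite type \<open>'a\<close>; an alphabet is a finite set of symbols.
  The type has to be infinite so that auxiliary, non-terminal symbols are available for every
  terminal alphabet. The set \<open>V\<^sup>*\<close> is \<^term>\<open>lists V\<close> and \<open>\<lambda>\<close> is \<^term>\<open>[]\<close>.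
\<close>

subsection \<open>Insertion and deletion rules\<close>

text \<open>\<open>Ins u \<alpha> v\<close> and \<open>Del u \<alpha> v\<close>: the inserted or deleted string \<open>\<alpha>\<close> is the middle argument.\<close>

datatype 'a insdel_rule =
    Ins "'a list" "'a list" "'a list"
  | Del "'a list" "'a list" "'a list"

fun rule_over :: "'a set \<Rightarrow> 'a insdel_rule \<Rightarrow> bool" where
  "rule_over V (Ins u \<alpha> v) \<longleftrightarrow> u \<in> lists V \<and> \<alpha> \<in> lists V \<and> v \<in> lists V \<and> \<alpha> \<noteq> []"
| "rule_over V (Del u \<alpha> v) \<longleftrightarrow> u \<in> lists V \<and> \<alpha> \<in> lists V \<and> v \<in> lists V \<and> \<alpha> \<noteq> []"

fun insdel_step :: "'a insdel_rule \<Rightarrow> 'a list \<Rightarrow> 'a list \<Rightarrow> bool" where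
  "insdel_step (Ins u \<alpha> v) x y \<longleftrightarrow>
     (\<exists>x\<^sub>1 x\<^sub>2. x = x\<^sub>1 @ u @ v @ x\<^sub>2 \<and> y = x\<^sub>1 @ u @ \<alpha> @ v @ x\<^sub>2)"
| "insdel_step (Del u \<alpha> v) x y \<longleftrightarrow>
     (\<exists>x\<^sub>1 x\<^sub>2. x = x\<^sub>1 @ u @ \<alpha> @ v @ x\<^sub>2 \<and> y = x\<^sub>1 @ u @ v @ x\<^sub>2)"

fun rule_size :: "nat \<Rightarrow> nat \<Rightarrow> nat \<Rightarrow> nat \<Rightarrow> nat \<Rightarrow> nat \<Rightarrow> 'a insdel_rule \<Rightarrow> bool" where
  "rule_size n m m' p q q' (Ins u \<alpha> v) \<longleftrightarrow> length \<alpha> \<le> n \<and> length u \<le> m \<and> length v \<le> m'"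
| "rule_size n m m' p q q' (Del u \<alpha> v) \<longleftrightarrow> length \<alpha> \<le> p \<and> length u \<le> q \<and> length v \<le> q'"

subsection \<open>Random context insertion-deletion systems\<close>

text \<open>A rule \<open>(r, P, Q)\<close> carries its permitting set \<open>P\<close> and its forbidding set \<open>Q\<close>.\<close>

type_synonym 'a rc_rule = "'a insdel_rule \<times> 'a set \<times> 'a set"

record 'a rc_system =
  alphabet :: "'a set"
  terminals :: "'a set"
  initials :: "'a list set"
  rules :: "'a rc_rule set"

definition rc_system :: "'a rc_system \<Rightarrow> bool" where
  "rc_system \<gamma> \<longleftrightarrow>
     finite (alphabet \<gamma>) \<and>
     terminals \<gamma> \<subseteq> alphabet \<gamma> \<and>
     finite (initials \<gamma>) \<and> initials \<gamma> \<subseteq> lists (alphabet \<gamma>) \<and>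
     finite (rules \<gamma>) \<and>
     (\<forall>(r, P, Q) \<in> rules \<gamma>. rule_over (alphabet \<gamma>) r \<and> P \<subseteq> alphabet \<gamma> \<and> Q \<subseteq> alphabet \<gamma>)"

fun rc_rule_step :: "'a rc_rule \<Rightarrow> 'a list \<Rightarrow> 'a list \<Rightarrow> bool" where
  "rc_rule_step (r, P, Q) w w' \<longleftrightarrow> insdel_step r w w' \<and> P \<subseteq> set w \<and> Q \<inter> set w = {}"

text \<open>
  Words need not be restricted to the alphabet here: in a well-formed system every word derived
  from a word over the alphabet is again over the alphabet.
\<close>

definition rc_step :: "'a rc_system \<Rightarrow> 'a list \<Rightarrow> 'a list \<Rightarrow> bool" where
  "rc_step \<gamma> w w' \<longleftrightarrow> (\<exists>r \<in> rules \<gamma>. rc_rule_step r w w')"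

definition rc_language :: "'a rc_system \<Rightarrow> 'a list set" where
  "rc_language \<gamma> = {w \<in> lists (terminals \<gamma>). \<exists>x \<in> initials \<gamma>. (rc_step \<gamma>)\<^sup>*\<^sup>* x w}"

definition rc_size :: "nat \<Rightarrow> nat \<Rightarrow> nat \<Rightarrow> nat \<Rightarrow> nat \<Rightarrow> nat \<Rightarrow> 'a rc_system \<Rightarrow> bool" where
  "rc_size n m m' p q q' \<gamma> \<longleftrightarrow> (\<forall>(r, P, Q) \<in> rules \<gamma>. rule_size n m m' p q q' r)"

text \<open>\<open>RC_INS_DEL n m m' p q q'\<close> is the family written \<open>RC INS\<^sub>n DEL\<^sub>p\<close> with superscripts
  \<open>m, m'\<close> on \<open>INS\<close> and \<open>q, q'\<close> on \<open>DEL\<close>.\<close>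

definition RC_INS_DEL ::
  "nat \<Rightarrow> nat \<Rightarrow> nat \<Rightarrow> nat \<Rightarrow> nat \<Rightarrow> nat \<Rightarrow> 'a::infinite list set set" where
  "RC_INS_DEL n m m' p q q' =
     {rc_language \<gamma> | \<gamma> :: 'a rc_system. rc_system \<gamma> \<and> rc_size n m m' p q q' \<gamma>}"

subsection \<open>Recursively enumerable languages\<close>

text \<open>
  As usual in formal language theory, the recursively enumerable languages are the languages
  generated by type-0 (unrestricted) grammars.
\<close>

record 'a grammar =
  nonterminal_symbols :: "'a set"
  terminal_symbols :: "'a set"
  start_symbol :: 'a
  productions :: "('a list \<times> 'a list) set"

definition type0_grammar :: "'a grammar \<Rightarrow> bool" where
  "type0_grammar G \<longleftrightarrow>
     finite (nonterminal_symbols G) \<and> finite (terminal_symbols G) \<and>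
     nonterminal_symbols G \<inter> terminal_symbols G = {} \<and>
     start_symbol G \<in> nonterminal_symbols G \<and>
     finite (productions G) \<and>
     (\<forall>(l, r) \<in> productions G.
        l \<in> lists (nonterminal_symbols G \<union> terminal_symbols G) \<and>
        r \<in> lists (nonterminal_symbols G \<union> terminal_symbols G) \<and>
        set l \<inter> nonterminal_symbols G \<noteq> {})"

definition grammar_step :: "'a grammar \<Rightarrow> 'a list \<Rightarrow> 'a list \<Rightarrow> bool" where
  "grammar_step G x y \<longleftrightarrow>
     (\<exists>(l, r) \<in> productions G. \<exists>x\<^sub>1 x\<^sub>2. x = x\<^sub>1 @ l @ x\<^sub>2 \<and> y = x\<^sub>1 @ r @ x\<^sub>2)"

definition grammar_language :: "'a grammar \<Rightarrow> 'a list set" where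
  "grammar_language G =
     {w \<in> lists (terminal_symbols G). (grammar_step G)\<^sup>*\<^sup>* [start_symbol G] w}"

definition RE :: "'a::infinite list set set" where
  "RE = {grammar_language G | G :: 'a grammar. type0_grammar G}"

end

theory Submission
  imports Defs
begin

text \<open>
  A type-0 grammar simulates a random context system with a head that sweeps over the word between
  two end markers, collects the set of letters it sees, compares it with the context conditions of
  a rule and then applies the rule anywhere on its way back.

  Conversely, code a sentential form \<open>a b \<dots>\<close> of a grammar as \<open>a Sep b Sep \<dots>\<close>. To apply a production
  \<open>(l, r)\<close>, insert a head somewhere, let it eat the code of \<open>l\<close> to its right symbol by symbol,
  and then put the code of \<open>r\<close> there. Context-free insertion puts things in arbitrary places, but a
  pair \<open>Probe q\<close> whose unique \<open>Probe\<close> has to be deleted in the left context \<open>s\<close> certifies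
  that \<open>q\<close> follows \<open>s\<close>. In this way the next head is created adjacent to the old one, a symbol is
  put next to the head, and a \<open>Target\<close> is placed behind a copy of the symbol \<open>c\<close> to be eaten. The
  head then deletes \<open>c\<close> and finally \<open>Target\<close>; since the code has no two equal adjacent symbols, exactly
  one \<open>c\<close> has disappeared when \<open>Target\<close> is next to the head.
\<close>

section \<open>Renaming of symbols\<close>

text \<open>Insertions see no context and deletions only one letter to the left, so the rules alone
  enforce neither adjacency nor an order of actions. Permitting and forbidding sets supply the
  order: the set of auxiliary symbols in the word acts as the state of a finite control, and every
  rule is tied to one such set. What this state cannot register is the deletion of an ordinary
  symbol, which leaves the set unchanged; \<open>Target\<close> and the separators are the remedy
  for that. Wrongly placed insertions are not prevented: they lead to words in which some auxiliary
  symbol can never be removed, and such words are not terminal. Both constructions use a symbol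
  datatype larger than \<open>'a\<close>, while the two language families live over
  \<open>'a\<close> itself. The results are carried back by a renaming that is injective on the
  finite alphabet involved and fixes the original letters.\<close>

lemma fresh_embedding:
  fixes \<iota> :: "'a::infinite \<Rightarrow> 'b"
  assumes "inj \<iota>" "finite X" "finite V" "X \<inter> range \<iota> \<subseteq> \<iota> ` V"
  obtains f :: "'b \<Rightarrow> 'a" where "inj_on f X" "\<And>a. f (\<iota> a) = a"
proof -
  have "infinite (- V)"
    using assms(3) by (simp add: Compl_eq_Diff_UNIV infinite_UNIV)
  \<comment> \<open>Enough replacement names outside \<open>V\<close> exist because the type is
    infinite. Avoiding \<open>V\<close> suffices for injectivity, since the embedded letters that
    occur in \<open>X\<close> come from \<open>V\<close>.\<close>
  then obtain B where B: "finite B" "card B = card (X - range \<iota>)" "B \<subseteq> - V"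
    using infinite_arbitrarily_large by blast
  then obtain g where g: "bij_betw g (X - range \<iota>) B"
    using assms(2) by (metis finite_Diff finite_same_card_bij)
  define f where "f s = (if s \<in> range \<iota> then inv \<iota> s else g s)" for s
  have "inj_on f X"
  proof (rule inj_onI)
    fix s t assume st: "s \<in> X" "t \<in> X" "f s = f t"
    have V: "s \<in> X \<Longrightarrow> s \<in> range \<iota> \<Longrightarrow> inv \<iota> s \<in> V" for s
      using assms(1,4) by (auto simp: inv_f_f)
    have nV: "s \<in> X \<Longrightarrow> s \<notin> range \<iota> \<Longrightarrow> g s \<notin> V" for s
      using g B(3) by (auto simp: bij_betw_def)
    show "s = t"
    proof (cases "s \<in> range \<iota> \<longleftrightarrow> t \<in> range \<iota>")
      case True
      show ?thesis
      proof (cases "s \<in> range \<iota>")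
        case True
        with \<open>s \<in> range \<iota> \<longleftrightarrow> t \<in> range \<iota>\<close> st(3) show ?thesis
          unfolding f_def by (metis f_inv_into_f)
      next
        case False
        with \<open>s \<in> range \<iota> \<longleftrightarrow> t \<in> range \<iota>\<close> have "s \<in> X - range \<iota>" "t \<in> X - range \<iota>" "g s = g t"
          using st by (auto simp: f_def)
        then show ?thesis using g unfolding bij_betw_def by (metis inj_onD)
      qed
    next
      case False
      then show ?thesis using st V[of s] V[of t] nV[of s] nV[of t] unfolding f_def by metis
    qed
  qed
  moreover have "f (\<iota> a) = a" for a
    using assms(1) by (simp add: f_def inv_f_f)
  ultimately show thesis using that by blast
qed

text \<open>A functional bisimulation: \<open>h\<close> carries steps forward, and each step from an
  image lifts. \<open>S\<close> will be the set of words over the alphabet, which is where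
  injectivity of the renaming is available.\<close>

lemma rtranclp_image_iff:
  assumes fwd: "\<And>x y. x \<in> S \<Longrightarrow> R x y \<Longrightarrow> y \<in> S \<and> R' (h x) (h y)"
    and bwd: "\<And>x z. x \<in> S \<Longrightarrow> R' (h x) z \<Longrightarrow> \<exists>y. z = h y \<and> R x y"
    and x: "x \<in> S"
  shows "R'\<^sup>*\<^sup>* (h x) z \<longleftrightarrow> (\<exists>y\<in>S. z = h y \<and> R\<^sup>*\<^sup>* x y)"
proof
  assume "R'\<^sup>*\<^sup>* (h x) z"
  then show "\<exists>y\<in>S. z = h y \<and> R\<^sup>*\<^sup>* x y"
  proof (induction rule: rtranclp_induct)
    case base
    then show ?case using x by blast
  next
    case (step y z)
    then obtain v where v: "v \<in> S" "y = h v" "R\<^sup>*\<^sup>* x v" by blast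
    with step.hyps(2) obtain u where "z = h u" "R v u" using bwd by blast
    with v have "u \<in> S" "R\<^sup>*\<^sup>* x u" using fwd[of v u] by (auto intro: rtranclp.rtrancl_into_rtrancl)
    with \<open>z = h u\<close> show ?case by blast
  qed
next
  assume "\<exists>y\<in>S. z = h y \<and> R\<^sup>*\<^sup>* x y"
  then obtain y where y: "z = h y" "R\<^sup>*\<^sup>* x y" by blast
  from y(2) have "y \<in> S \<and> R'\<^sup>*\<^sup>* (h x) (h y)"
  proof (induction rule: rtranclp_induct)
    case base
    then show ?case using x by simp
  next
    case (step u v)
    then show ?case using fwd[of u v] by (meson rtranclp.rtrancl_into_rtrancl)
  qed
  then show "R'\<^sup>*\<^sup>* (h x) z" using y by simp
qed

lemma map_eq_append3E:
  assumes "map f w = x @ y @ z"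
  obtains x' y' z' where "w = x' @ y' @ z'" "x = map f x'" "y = map f y'" "z = map f z'"
proof -
  obtain x' v where "w = x' @ v" "map f x' = x" "map f v = y @ z"
    using assms by (metis map_eq_append_conv)
  moreover then obtain y' z' where "v = y' @ z'" "map f y' = y" "map f z' = z"
    by (metis map_eq_append_conv)
  ultimately show thesis using that by simp
qed

lemma inj_on_image_subset_iff:
  assumes "inj_on f V" "A \<subseteq> V" "B \<subseteq> V"
  shows "f ` A \<subseteq> f ` B \<longleftrightarrow> A \<subseteq> B"
proof
  assume AB: "f ` A \<subseteq> f ` B"
  show "A \<subseteq> B"
  proof
    fix a assume "a \<in> A"
    with AB have "f a \<in> f ` B" by blast
    with \<open>a \<in> A\<close> assms show "a \<in> B" by (meson inj_on_image_mem_iff subsetD)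
  qed
qed blast

lemma map_in_lists_image_iff:
  assumes "inj_on f V" "x \<in> lists V" "T \<subseteq> V"
  shows "map f x \<in> lists (f ` T) \<longleftrightarrow> x \<in> lists T"
  using inj_on_image_subset_iff[OF assms(1), of "set x" T] assms(2,3) by (simp add: lists_eq_set)

lemma map_eq_map_iff_lists:
  assumes "inj_on f V" "x \<in> lists V" "y \<in> lists V"
  shows "map f x = map f y \<longleftrightarrow> x = y"
proof -
  have "inj_on f (set x \<union> set y)"
    using assms by (auto simp: lists_eq_set intro: inj_on_subset)
  then show ?thesis by (simp add: inj_on_map_eq_map)
qed

section \<open>Renaming grammars and random context systems\<close>

definition rename_grammar :: "('a \<Rightarrow> 'b) \<Rightarrow> 'a grammar \<Rightarrow> 'b grammar" where
  "rename_grammar f G =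
    \<lparr>nonterminal_symbols = f ` nonterminal_symbols G, terminal_symbols = f ` terminal_symbols G,
     start_symbol = f (start_symbol G), productions = map_prod (map f) (map f) ` productions G\<rparr>"

lemma rename_grammar_simps [simp]:
  "terminal_symbols (rename_grammar f G) = f ` terminal_symbols G"
  "start_symbol (rename_grammar f G) = f (start_symbol G)"
  by (simp_all add: rename_grammar_def)

lemma type0_rename_grammar:
  assumes G: "type0_grammar G" and f: "inj_on f (nonterminal_symbols G \<union> terminal_symbols G)"
  shows "type0_grammar (rename_grammar f G)"
proof -
  have "f ` nonterminal_symbols G \<inter> f ` terminal_symbols G = {}"
    using G f by (subst inj_on_image_Int[OF f, symmetric]) (auto simp: type0_grammar_def)
  moreover have "map f x \<in> lists (f ` N \<union> f ` T)" if "x \<in> lists (N \<union> T)" for x N T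
    using that by (metis image_Un image_eqI lists_image)
  moreover have "f ` set l \<inter> f ` N \<noteq> {}" if "set l \<inter> N \<noteq> {}" for l N
    using that by auto
  ultimately show ?thesis
    using G unfolding type0_grammar_def rename_grammar_def
    by (simp add: case_prod_beta del: in_lists_conv_set)
qed

lemma grammar_language_rename:
  assumes G: "type0_grammar G" and f: "inj_on f (nonterminal_symbols G \<union> terminal_symbols G)"
  shows "grammar_language (rename_grammar f G) = map f ` grammar_language G"
proof -
  let ?V = "nonterminal_symbols G \<union> terminal_symbols G" and ?G = "rename_grammar f G"
  have P: "l \<in> lists ?V \<and> r \<in> lists ?V" if "(l, r) \<in> productions G" for l r
    using that G by (auto simp: type0_grammar_def)
  have fwd: "y \<in> lists ?V \<and> grammar_step ?G (map f x) (map f y)"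
    if "x \<in> lists ?V" "grammar_step G x y" for x y
  proof -
    obtain l r x1 x2 where *: "(l, r) \<in> productions G" "x = x1 @ l @ x2" "y = x1 @ r @ x2"
      using \<open>grammar_step G x y\<close> by (auto simp: grammar_step_def)
    then have "(map f l, map f r) \<in> productions ?G"
      by (auto simp: rename_grammar_def intro: rev_image_eqI)
    moreover have "map f x = map f x1 @ map f l @ map f x2" "map f y = map f x1 @ map f r @ map f x2"
      using * by auto
    ultimately have "grammar_step ?G (map f x) (map f y)"
      unfolding grammar_step_def by blast
    then show ?thesis using * P[OF *(1)] that(1) by auto
  qed
  have bwd: "\<exists>y. z = map f y \<and> grammar_step G x y"
    if x: "x \<in> lists ?V" and st: "grammar_step ?G (map f x) z" for x z
  proof -
    obtain l r x1 x2 where *: "(l, r) \<in> productions G" "map f x = x1 @ map f l @ x2"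
      "z = x1 @ map f r @ x2"
      using st by (auto simp: grammar_step_def rename_grammar_def)
    obtain y1 l' y2 where y: "x = y1 @ l' @ y2" "x1 = map f y1" "map f l = map f l'" "x2 = map f y2"
      using *(2) by (rule map_eq_append3E)
    \<comment> \<open>Only the image of the rewritten factor is known to match; injectivity on the
      alphabet makes it \<open>l\<close> itself, so the renaming enables no additional
      rewriting.\<close>
    have "l' = l" using y x P[OF *(1)] map_eq_map_iff_lists[OF f] by auto
    then have "grammar_step G x (y1 @ r @ y2)"
      using *(1) y(1) unfolding grammar_step_def by blast
    then show ?thesis using *(3) y by (intro exI[of _ "y1 @ r @ y2"]) auto
  qed
  have S: "[start_symbol G] \<in> lists ?V" using G by (auto simp: type0_grammar_def)
  have T: "map f y \<in> lists (f ` terminal_symbols G) \<longleftrightarrow> y \<in> lists (terminal_symbols G)"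
    if "y \<in> lists ?V" for y
    using map_in_lists_image_iff[OF f that] by blast
  have "(grammar_step ?G)\<^sup>*\<^sup>* [f (start_symbol G)] z \<longleftrightarrow>
      (\<exists>y\<in>lists ?V. z = map f y \<and> (grammar_step G)\<^sup>*\<^sup>* [start_symbol G] y)" for z
    using rtranclp_image_iff[where h = "map f" and S = "lists ?V" and x = "[start_symbol G]"
        and R = "grammar_step G" and R' = "grammar_step ?G", OF fwd bwd S] by simp
  note star = this
  show ?thesis
  proof (intro set_eqI iffI)
    fix z assume "z \<in> grammar_language ?G"
    then have "z \<in> lists (f ` terminal_symbols G)" "(grammar_step ?G)\<^sup>*\<^sup>* [f (start_symbol G)] z"
      by (simp_all add: grammar_language_def)
    then obtain y where "y \<in> lists ?V" "z = map f y" "(grammar_step G)\<^sup>*\<^sup>* [start_symbol G] y"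
      using star by blast
    then show "z \<in> map f ` grammar_language G"
      using T[of y] \<open>z \<in> lists (f ` terminal_symbols G)\<close> by (simp add: grammar_language_def)
  next
    fix z assume "z \<in> map f ` grammar_language G"
    then obtain y where y: "z = map f y" "y \<in> lists (terminal_symbols G)"
      "(grammar_step G)\<^sup>*\<^sup>* [start_symbol G] y"
      by (auto simp: grammar_language_def)
    then have "y \<in> lists ?V" by auto
    with y T[of y] star[of z] show "z \<in> grammar_language ?G"
      by (simp add: grammar_language_def) blast
  qed
qed

definition rename_rc :: "('a \<Rightarrow> 'b) \<Rightarrow> 'a rc_system \<Rightarrow> 'b rc_system" where
  "rename_rc f \<gamma> =
    \<lparr>alphabet = f ` alphabet \<gamma>, terminals = f ` terminals \<gamma>, initials = map f ` initials \<gamma>,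
     rules = (\<lambda>(r, P, Q). (map_insdel_rule f r, f ` P, f ` Q)) ` rules \<gamma>\<rparr>"

lemma rename_rc_simps [simp]:
  "terminals (rename_rc f \<gamma>) = f ` terminals \<gamma>"
  "initials (rename_rc f \<gamma>) = map f ` initials \<gamma>"
  by (simp_all add: rename_rc_def)

lemma rule_over_map: "rule_over V r \<Longrightarrow> rule_over (f ` V) (map_insdel_rule f r)"
  by (cases r) auto

lemma rc_system_rename: "rc_system \<gamma> \<Longrightarrow> rc_system (rename_rc f \<gamma>)"
  unfolding rc_system_def rename_rc_def
  by (auto simp add: case_prod_beta image_mono rule_over_map lists_image)

lemma rule_size_map: "rule_size n m m' p q q' (map_insdel_rule f r) = rule_size n m m' p q q' r"
  by (cases r) auto

lemma rc_size_rename: "rc_size n m m' p q q' \<gamma> \<Longrightarrow> rc_size n m m' p q q' (rename_rc f \<gamma>)"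
  unfolding rc_size_def rename_rc_def
  by (simp add: case_prod_beta rule_size_map)

lemma insdel_step_map:
  assumes "rule_over V r" "w \<in> lists V" "insdel_step r w w'"
  shows "w' \<in> lists V \<and> insdel_step (map_insdel_rule f r) (map f w) (map f w')"
proof (cases r)
  case (Ins u a v)
  then obtain x1 x2 where "w = x1 @ u @ v @ x2" "w' = x1 @ u @ a @ v @ x2" using assms(3) by auto
  moreover have "insdel_step (map_insdel_rule f r) (map f w) (map f w')"
    unfolding Ins insdel_rule.map insdel_step.simps
    by (rule exI[of _ "map f x1"], rule exI[of _ "map f x2"]) (simp add: calculation)
  ultimately show ?thesis using assms Ins by auto
next
  case (Del u a v)
  then obtain x1 x2 where "w = x1 @ u @ a @ v @ x2" "w' = x1 @ u @ v @ x2" using assms(3) by auto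
  moreover have "insdel_step (map_insdel_rule f r) (map f w) (map f w')"
    unfolding Del insdel_rule.map insdel_step.simps
    by (rule exI[of _ "map f x1"], rule exI[of _ "map f x2"]) (simp add: calculation)
  ultimately show ?thesis using assms Del by auto
qed

text \<open>The matched block is pulled back as a whole, and injectivity on \<open>V\<close>
  identifies it with the left side of the rule, contexts included.\<close>

lemma insdel_step_map_rev:
  assumes f: "inj_on f V" and "rule_over V r" "w \<in> lists V"
    and st: "insdel_step (map_insdel_rule f r) (map f w) z"
  shows "\<exists>w'. z = map f w' \<and> insdel_step r w w'"
proof (cases r)
  case (Ins u a v)
  then obtain x1 x2 where *: "map f w = x1 @ map f (u @ v) @ x2"
    "z = x1 @ map f u @ map f a @ map f v @ x2" using st by auto
  obtain y1 l y2 where y: "w = y1 @ l @ y2" "x1 = map f y1" "map f (u @ v) = map f l" "x2 = map f y2"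
    using *(1) by (rule map_eq_append3E)
  have "l = u @ v" using y assms(2,3) Ins map_eq_map_iff_lists[OF f, of "u @ v" l] by auto
  then have "insdel_step r w (y1 @ u @ a @ v @ y2)" using y Ins by auto
  then show ?thesis using * y by (intro exI[of _ "y1 @ u @ a @ v @ y2"]) auto
next
  case (Del u a v)
  then obtain x1 x2 where *: "map f w = x1 @ map f (u @ a @ v) @ x2"
    "z = x1 @ map f u @ map f v @ x2" using st by auto
  obtain y1 l y2 where y: "w = y1 @ l @ y2" "x1 = map f y1" "map f (u @ a @ v) = map f l"
    "x2 = map f y2"
    using *(1) by (rule map_eq_append3E)
  have "l = u @ a @ v" using y assms(2,3) Del map_eq_map_iff_lists[OF f, of "u @ a @ v" l] by auto
  then have "insdel_step r w (y1 @ u @ v @ y2)" using y Del by auto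
  then show ?thesis using * y by (intro exI[of _ "y1 @ u @ v @ y2"]) auto
qed

lemma rc_language_rename:
  assumes \<gamma>: "rc_system \<gamma>" and f: "inj_on f (alphabet \<gamma>)"
  shows "rc_language (rename_rc f \<gamma>) = map f ` rc_language \<gamma>"
proof -
  let ?V = "alphabet \<gamma>" and ?g = "rename_rc f \<gamma>"
  have P: "rule_over ?V r \<and> P \<subseteq> ?V \<and> Q \<subseteq> ?V" if "(r, P, Q) \<in> rules \<gamma>" for r P Q
    using that \<gamma> by (auto simp: rc_system_def)
  \<comment> \<open>For forbidding sets injectivity matters in the forward direction too:
    identifying two letters could make a forbidden one appear.\<close>
  have cond: "f ` P \<subseteq> f ` set x \<longleftrightarrow> P \<subseteq> set x" "f ` Q \<inter> f ` set x = {} \<longleftrightarrow> Q \<inter> set x = {}"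
    if "x \<in> lists ?V" "P \<subseteq> ?V" "Q \<subseteq> ?V" for P Q x
  proof -
    have x: "set x \<subseteq> ?V" using that by auto
    show "f ` P \<subseteq> f ` set x \<longleftrightarrow> P \<subseteq> set x" using inj_on_image_subset_iff[OF f that(2) x] .
    show "f ` Q \<inter> f ` set x = {} \<longleftrightarrow> Q \<inter> set x = {}"
      using inj_on_image_Int[OF f that(3) x] by (metis image_is_empty)
  qed
  have fwd: "y \<in> lists ?V \<and> rc_step ?g (map f x) (map f y)"
    if x: "x \<in> lists ?V" and st: "rc_step \<gamma> x y" for x y
  proof -
    obtain r P Q where *: "(r, P, Q) \<in> rules \<gamma>" "insdel_step r x y" "P \<subseteq> set x" "Q \<inter> set x = {}"
      using st by (auto simp: rc_step_def)
    then have "(map_insdel_rule f r, f ` P, f ` Q) \<in> rules ?g"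
      by (auto simp: rename_rc_def intro: rev_image_eqI)
    moreover have "rc_rule_step (map_insdel_rule f r, f ` P, f ` Q) (map f x) (map f y)"
      using * P[OF *(1)] cond[OF x, of P Q] insdel_step_map[OF _ x, of r y f] by simp
    ultimately show ?thesis using insdel_step_map[OF _ x *(2)] P[OF *(1)] unfolding rc_step_def by blast
  qed
  have bwd: "\<exists>y. z = map f y \<and> rc_step \<gamma> x y"
    if x: "x \<in> lists ?V" and st: "rc_step ?g (map f x) z" for x z
  proof -
    obtain r P Q where *: "(r, P, Q) \<in> rules \<gamma>" "insdel_step (map_insdel_rule f r) (map f x) z"
      "f ` P \<subseteq> f ` set x" "f ` Q \<inter> f ` set x = {}"
      using st by (auto simp: rc_step_def rename_rc_def)
    obtain y where y: "z = map f y" "insdel_step r x y"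
      using insdel_step_map_rev[OF f _ x *(2)] P[OF *(1)] by blast
    have "rc_rule_step (r, P, Q) x y"
      using * y cond[OF x, of P Q] P[OF *(1)] by simp
    then show ?thesis using *(1) y(1) unfolding rc_step_def by blast
  qed
  have star: "(rc_step ?g)\<^sup>*\<^sup>* (map f x) z \<longleftrightarrow> (\<exists>y\<in>lists ?V. z = map f y \<and> (rc_step \<gamma>)\<^sup>*\<^sup>* x y)"
    if "x \<in> initials \<gamma>" for x z
  proof -
    have "x \<in> lists ?V" using that \<gamma> by (auto simp: rc_system_def)
    with rtranclp_image_iff[where h = "map f" and S = "lists ?V"
        and R = "rc_step \<gamma>" and R' = "rc_step ?g", OF fwd bwd] show ?thesis by simp
  qed
  have TV: "terminals \<gamma> \<subseteq> ?V" using \<gamma> by (simp add: rc_system_def)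
  have T: "map f y \<in> lists (f ` terminals \<gamma>) \<longleftrightarrow> y \<in> lists (terminals \<gamma>)"
    if "y \<in> lists ?V" for y
    using map_in_lists_image_iff[OF f that TV] .
  show ?thesis
  proof (intro set_eqI iffI)
    fix z assume "z \<in> rc_language ?g"
    then obtain x where x: "z \<in> lists (f ` terminals \<gamma>)" "x \<in> initials \<gamma>" "(rc_step ?g)\<^sup>*\<^sup>* (map f x) z"
      by (auto simp: rc_language_def)
    then obtain y where "y \<in> lists ?V" "z = map f y" "(rc_step \<gamma>)\<^sup>*\<^sup>* x y"
      using star by blast
    then show "z \<in> map f ` rc_language \<gamma>"
      using T[of y] x unfolding rc_language_def by blast
  next
    fix z assume "z \<in> map f ` rc_language \<gamma>"
    then obtain y x where y: "z = map f y" "y \<in> lists (terminals \<gamma>)"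
      "x \<in> initials \<gamma>" "(rc_step \<gamma>)\<^sup>*\<^sup>* x y"
      by (auto simp: rc_language_def)
    moreover have "y \<in> lists ?V" using y TV by auto
    moreover from this y star[of x z] have "(rc_step ?g)\<^sup>*\<^sup>* (map f x) z" by blast
    ultimately show "z \<in> rc_language ?g"
      using T[of y] unfolding rc_language_def by auto
  qed
qed

section \<open>Random context systems generate recursively enumerable languages\<close>

text \<open>Seen as a rewriting rule from \<open>lhs r\<close> to \<open>rhs r\<close>, an insertion
  or deletion becomes one production, and the two kinds need no separate treatment.\<close>

fun lhs :: "'a insdel_rule \<Rightarrow> 'a list" where
  "lhs (Ins u a v) = u @ v"
| "lhs (Del u a v) = u @ a @ v"

fun rhs :: "'a insdel_rule \<Rightarrow> 'a list" where
  "rhs (Ins u a v) = u @ a @ v"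
| "rhs (Del u a v) = u @ v"

lemma insdel_step_iff: "insdel_step r x y \<longleftrightarrow> (\<exists>z z'. x = z @ lhs r @ z' \<and> y = z @ rhs r @ z')"
  by (cases r) auto

lemma lhs_over: "rule_over V r \<Longrightarrow> lhs r \<in> lists V"
  and rhs_over: "rule_over V r \<Longrightarrow> rhs r \<in> lists V"
  by (cases r; auto)+

text \<open>The word on the right contains \<open>h\<close> exactly once, so any occurrence of
  \<open>h\<close> is that one. Applied to markers, it locates the place of a rewriting.\<close>

lemma append_Cons_unique:
  assumes "u @ h # v = p @ h # q" "h \<notin> set p" "h \<notin> set q"
  shows "u = p \<and> v = q"
  using assms append_Cons_eq_iff[of h p q u v] by metis

text \<open>A scanning head \<open>Scan D\<close> carries the set \<open>D\<close> of letters passed so far; once it reaches the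
  right end it knows which permitting and forbidding conditions hold. The left end marker changes
  from \<open>Idle\<close> to \<open>Busy\<close> while a head is present, so there is never a second one.\<close>

datatype 'a scan_symbol =
    Sym 'a | Start | Idle | Busy | End | Scan "'a set" | Apply "'a rc_rule" | Back | Emit

text \<open>The context test lies in the choice of productions: a rule is loaded at
  \<open>End\<close> only for those \<open>D\<close> that satisfy its conditions.
  \<open>Apply \<rho>\<close> then walks left and may stop anywhere, which models the free choice of
  position, while \<open>Back\<close> disappears only next to \<open>Busy\<close>.\<close>

definition scan_productions :: "'a rc_system \<Rightarrow> ('a scan_symbol list \<times> 'a scan_symbol list) set" where
  "scan_productions \<gamma> =
     (\<lambda>w. ([Start], Idle # map Sym w @ [End])) ` initials \<gamma> \<union>
     {([Idle], [Busy, Scan {}]), ([Busy, Back], [Idle]), ([Idle], [Emit]), ([Emit, End], [])} \<union>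
     (\<lambda>(D, a). ([Scan D, Sym a], [Sym a, Scan (insert a D)])) ` (Pow (alphabet \<gamma>) \<times> alphabet \<gamma>) \<union>
     (\<lambda>(\<rho>, D). ([Scan D, End], [Apply \<rho>, End])) `
       {(\<rho>, D) \<in> rules \<gamma> \<times> Pow (alphabet \<gamma>). fst (snd \<rho>) \<subseteq> D \<and> snd (snd \<rho>) \<inter> D = {}} \<union>
     (\<lambda>(a, \<rho>). ([Sym a, Apply \<rho>], [Apply \<rho>, Sym a])) ` (alphabet \<gamma> \<times> rules \<gamma>) \<union>
     (\<lambda>\<rho>. (Apply \<rho> # map Sym (lhs (fst \<rho>)), Back # map Sym (rhs (fst \<rho>)))) ` rules \<gamma> \<union>
     (\<lambda>a. ([Sym a, Back], [Back, Sym a])) ` alphabet \<gamma> \<union>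
     (\<lambda>a. ([Emit, Sym a], [Sym a, Emit])) ` terminals \<gamma>"

definition scan_grammar :: "'a rc_system \<Rightarrow> 'a scan_symbol grammar" where
  "scan_grammar \<gamma> =
    \<lparr>nonterminal_symbols = Sym ` (alphabet \<gamma> - terminals \<gamma>) \<union>
       {Start, Idle, Busy, End, Back, Emit} \<union> Scan ` Pow (alphabet \<gamma>) \<union> Apply ` rules \<gamma>,
     terminal_symbols = Sym ` terminals \<gamma>,
     start_symbol = Start,
     productions = scan_productions \<gamma>\<rparr>"

lemma scan_grammar_simps [simp]:
  "terminal_symbols (scan_grammar \<gamma>) = Sym ` terminals \<gamma>"
  "start_symbol (scan_grammar \<gamma>) = Start"
  "productions (scan_grammar \<gamma>) = scan_productions \<gamma>"
  by (simp_all add: scan_grammar_def)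

locale rc_to_grammar =
  fixes \<gamma> :: "'a rc_system"
  assumes rc: "rc_system \<gamma>"
begin

abbreviation "V \<equiv> alphabet \<gamma>"
abbreviation "G \<equiv> scan_grammar \<gamma>"

lemma rule_over_fst: "\<rho> \<in> rules \<gamma> \<Longrightarrow> rule_over V (fst \<rho>)"
  using rc by (cases \<rho>) (auto simp: rc_system_def)

text \<open>Each left side contains a control symbol, hence a nonterminal. This covers rules with
  empty \<open>lhs\<close>, such as an insertion without contexts, because
  \<open>Apply \<rho>\<close> stands in front.\<close>

lemma type0_scan_grammar: "type0_grammar G"
proof -
  have fin: "finite V" "finite (terminals \<gamma>)" "finite (initials \<gamma>)" "finite (rules \<gamma>)"
    using rc by (auto simp: rc_system_def intro: finite_subset)
  have "finite {(\<rho>, D) \<in> rules \<gamma> \<times> Pow V. fst (snd \<rho>) \<subseteq> D \<and> snd (snd \<rho>) \<inter> D = {}}"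
    by (rule finite_subset[of _ "rules \<gamma> \<times> Pow V"]) (use fin in auto)
  then have "finite (scan_productions \<gamma>)"
    unfolding scan_productions_def using fin by simp
  moreover have "l \<in> lists (nonterminal_symbols G \<union> terminal_symbols G) \<and>
      r \<in> lists (nonterminal_symbols G \<union> terminal_symbols G) \<and>
      set l \<inter> nonterminal_symbols G \<noteq> {}" if "(l, r) \<in> scan_productions \<gamma>" for l r
  proof -
    have T: "terminals \<gamma> \<subseteq> V" and A: "initials \<gamma> \<subseteq> lists V" using rc by (auto simp: rc_system_def)
    have lr: "a \<in> V" if "(r, P, Q) \<in> rules \<gamma>" "a \<in> set (lhs r) \<union> set (rhs r)" for r P Q a
      using rule_over_fst[OF that(1)] that(2) lhs_over[of V r] rhs_over[of V r]
      by (auto simp del: in_lists_conv_set simp: lists_eq_set)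
    have ini: "a \<in> V" if "w \<in> initials \<gamma>" "a \<in> set w" for w a using A that by auto
    have *: "nonterminal_symbols G \<union> terminal_symbols G = Sym ` V \<union>
      {Start, Idle, Busy, End, Back, Emit} \<union> Scan ` Pow V \<union> Apply ` rules \<gamma>"
      using T by (auto simp: scan_grammar_def)
    show ?thesis
      using that T unfolding * scan_productions_def lists_eq_set
      by (auto simp: scan_grammar_def intro!: imageI intro: lr ini)
  qed
  moreover have "finite (nonterminal_symbols G)" "finite (terminal_symbols G)"
    "nonterminal_symbols G \<inter> terminal_symbols G = {}" "start_symbol G \<in> nonterminal_symbols G"
    using fin by (auto simp: scan_grammar_def)
  ultimately show ?thesis
    unfolding type0_grammar_def scan_grammar_simps(3) by blast
qed

section \<open>Invariant of the scanning grammar\<close>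

definition derivable :: "'a list \<Rightarrow> bool" where
  "derivable w \<longleftrightarrow> (\<exists>x\<in>initials \<gamma>. (rc_step \<gamma>)\<^sup>*\<^sup>* x w)"

text \<open>The letters always spell a derivable word, and the control symbol fixes the case.
  \<open>form_Apply\<close> states the conditions for the whole of \<open>x @ y\<close>, so they
  stay true while the head walks left.\<close>

inductive form :: "'a scan_symbol list \<Rightarrow> bool" where
  form_Start: "form [Start]"
| form_Idle: "derivable w \<Longrightarrow> form (Idle # map Sym w @ [End])"
| form_Scan: "derivable (x @ y) \<Longrightarrow> form (Busy # map Sym x @ Scan (set x) # map Sym y @ [End])"
| form_Apply: "derivable (x @ y) \<Longrightarrow> \<rho> \<in> rules \<gamma> \<Longrightarrow> fst (snd \<rho>) \<subseteq> set (x @ y) \<Longrightarrow>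
    snd (snd \<rho>) \<inter> set (x @ y) = {} \<Longrightarrow> form (Busy # map Sym x @ Apply \<rho> # map Sym y @ [End])"
| form_Back: "derivable (x @ y) \<Longrightarrow> form (Busy # map Sym x @ Back # map Sym y @ [End])"
| form_Emit: "derivable (x @ y) \<Longrightarrow> form (map Sym x @ Emit # map Sym y @ [End])"
| form_done: "derivable x \<Longrightarrow> form (map Sym x)"

text \<open>The first of the inversion rules for the invariant, one for each control symbol: the
  symbol decides which case applies, and its uniqueness fixes what lies on either side.\<close>

lemma form_StartD:
  assumes "form (u @ Start # v)"
  shows "u = [] \<and> v = []"
proof -
  have "Start \<in> set (u @ Start # v)" by simp
  with assms show ?thesis by (cases rule: form.cases) (auto simp: append_eq_Cons_conv)
qed

lemma form_IdleD:
  assumes "form (u @ Idle # v)"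
  obtains w where "u = []" "v = map Sym w @ [End]" "derivable w"
proof -
  have mem: "Idle \<in> set (u @ Idle # v)" by simp
  from assms show thesis
  proof (cases rule: form.cases)
    case (form_Idle w)
    then show thesis using that append_Cons_unique[of u Idle v "[]" "map Sym w @ [End]"] by auto
  qed (use mem in auto)
qed

lemma form_ScanD:
  assumes "form (u @ Scan D # v)"
  obtains x y where "u = Busy # map Sym x" "D = set x" "v = map Sym y @ [End]" "derivable (x @ y)"
proof -
  have mem: "Scan D \<in> set (u @ Scan D # v)" by simp
  from assms show thesis
  proof (cases rule: form.cases)
    case (form_Scan x y)
    have D: "D = set x" using mem unfolding form_Scan(1) by auto
    then show thesis
      using that form_Scan append_Cons_unique[of u "Scan D" v "Busy # map Sym x" "map Sym y @ [End]"]
      by auto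
  qed (use mem in auto)
qed

lemma form_ApplyD:
  assumes "form (u @ Apply \<rho> # v)"
  obtains x y where "u = Busy # map Sym x" "v = map Sym y @ [End]" "derivable (x @ y)"
    "\<rho> \<in> rules \<gamma>" "fst (snd \<rho>) \<subseteq> set (x @ y)" "snd (snd \<rho>) \<inter> set (x @ y) = {}"
proof -
  have mem: "Apply \<rho> \<in> set (u @ Apply \<rho> # v)" by simp
  from assms show thesis
  proof (cases rule: form.cases)
    case (form_Apply x y \<rho>')
    have D: "\<rho>' = \<rho>" using mem unfolding form_Apply(1) by auto
    then have "u = Busy # map Sym x \<and> v = map Sym y @ [End]"
      using form_Apply(1) append_Cons_unique[of u "Apply \<rho>" v "Busy # map Sym x" "map Sym y @ [End]"]
      by auto
    then show thesis using that form_Apply D by blast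
  qed (use mem in auto)
qed

lemma form_BackD:
  assumes "form (u @ Back # v)"
  obtains x y where "u = Busy # map Sym x" "v = map Sym y @ [End]" "derivable (x @ y)"
proof -
  have mem: "Back \<in> set (u @ Back # v)" by simp
  from assms show thesis
  proof (cases rule: form.cases)
    case (form_Back x y)
    then show thesis
      using that append_Cons_unique[of u Back v "Busy # map Sym x" "map Sym y @ [End]"] by auto
  qed (use mem in auto)
qed

lemma form_EmitD:
  assumes "form (u @ Emit # v)"
  obtains x y where "u = map Sym x" "v = map Sym y @ [End]" "derivable (x @ y)"
proof -
  have mem: "Emit \<in> set (u @ Emit # v)" by simp
  from assms show thesis
  proof (cases rule: form.cases)
    case (form_Emit x y)
    then show thesis
      using that append_Cons_unique[of u Emit v "map Sym x" "map Sym y @ [End]"] by auto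
  qed (use mem in auto)
qed

lemma derivable_step:
  assumes "derivable (x @ lhs (fst \<rho>) @ y)" "\<rho> \<in> rules \<gamma>"
    "fst (snd \<rho>) \<subseteq> set (x @ lhs (fst \<rho>) @ y)" "snd (snd \<rho>) \<inter> set (x @ lhs (fst \<rho>) @ y) = {}"
  shows "derivable (x @ rhs (fst \<rho>) @ y)"
proof -
  have "rc_rule_step \<rho> (x @ lhs (fst \<rho>) @ y) (x @ rhs (fst \<rho>) @ y)"
    using assms by (cases \<rho>) (auto simp: insdel_step_iff)
  then have "rc_step \<gamma> (x @ lhs (fst \<rho>) @ y) (x @ rhs (fst \<rho>) @ y)"
    using assms(2) unfolding rc_step_def by blast
  then show ?thesis
    using assms(1) unfolding derivable_def by (meson rtranclp.rtrancl_into_rtrancl)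
qed

lemma map_Sym_append_End:
  "map Sym p @ v = map Sym y @ [End] \<Longrightarrow> \<exists>y'. y = p @ y' \<and> v = map Sym y' @ [End]"
proof (induction p arbitrary: y)
  case (Cons a p)
  then show ?case by (cases y) auto
qed auto

lemma form_step:
  assumes "form w" "grammar_step G w w'"
  shows "form w'"
proof -
  obtain l r u v where lr: "(l, r) \<in> scan_productions \<gamma>" and w: "w = u @ l @ v" "w' = u @ r @ v"
    using assms(2) by (auto simp: grammar_step_def)
  from lr consider
    (start) x where "x \<in> initials \<gamma>" "l = [Start]" "r = Idle # map Sym x @ [End]"
  | (scan) "l = [Idle]" "r = [Busy, Scan {}]"
  | (idle) "l = [Busy, Back]" "r = [Idle]"
  | (emit) "l = [Idle]" "r = [Emit]"
  | (erase) "l = [Emit, End]" "r = []"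
  | (scan_sym) D a where "l = [Scan D, Sym a]" "r = [Sym a, Scan (insert a D)]"
  | (scan_end) D \<rho> where "\<rho> \<in> rules \<gamma>" "fst (snd \<rho>) \<subseteq> D" "snd (snd \<rho>) \<inter> D = {}"
      "l = [Scan D, End]" "r = [Apply \<rho>, End]"
  | (apply_sym) a \<rho> where "l = [Sym a, Apply \<rho>]" "r = [Apply \<rho>, Sym a]"
  | (app) \<rho> where "l = Apply \<rho> # map Sym (lhs (fst \<rho>))" "r = Back # map Sym (rhs (fst \<rho>))"
  | (back_sym) a where "l = [Sym a, Back]" "r = [Back, Sym a]"
  | (emit_sym) a where "l = [Emit, Sym a]" "r = [Sym a, Emit]"
    unfolding scan_productions_def by auto
  then show ?thesis
  proof cases
    case start
    then have "u = [] \<and> v = []" using form_StartD assms(1) w by simp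
    moreover have "derivable x" using start by (auto simp: derivable_def)
    ultimately show ?thesis using w start form_Idle by simp
  next
    case scan
    then obtain z where "u = []" "v = map Sym z @ [End]" "derivable z"
      using form_IdleD[of u v] assms(1) w by auto
    then show ?thesis using w scan form_Scan[of "[]" z] by simp
  next
    case idle
    then obtain x y where "u @ [Busy] = Busy # map Sym x" "v = map Sym y @ [End]" "derivable (x @ y)"
      using form_BackD[of "u @ [Busy]" v] assms(1) w by auto
    \<comment> \<open>\<open>Busy\<close> is not a letter, so \<open>Back\<close> touches it only
      after passing all of \<open>x\<close>.\<close>
    moreover from this have "u = [] \<and> x = []"
      by (cases u; cases x rule: rev_cases) auto
    ultimately show ?thesis using w idle form_Idle[of y] by simp
  next
    case emit
    then obtain z where "u = []" "v = map Sym z @ [End]" "derivable z"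
      using form_IdleD[of u v] assms(1) w by auto
    then show ?thesis using w emit form_Emit[of "[]" z] by simp
  next
    case erase
    then obtain x y where "u = map Sym x" "End # v = map Sym y @ [End]" "derivable (x @ y)"
      using form_EmitD[of u "End # v"] assms(1) w by auto
    then show ?thesis using w erase form_done[of x] by (cases y) auto
  next
    case scan_sym
    then obtain x y where xy: "u = Busy # map Sym x" "D = set x" "map Sym [a] @ v = map Sym y @ [End]"
      "derivable (x @ y)"
      using form_ScanD[of u D "Sym a # v"] assms(1) w by auto
    obtain y' where "y = [a] @ y'" "v = map Sym y' @ [End]" using map_Sym_append_End[OF xy(3)] by blast
    then show ?thesis using w scan_sym xy form_Scan[of "x @ [a]" y'] by simp
  next
    case scan_end
    then have "form (u @ Scan D # End # v)" using assms(1) w by simp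
    then obtain x y where xy: "u = Busy # map Sym x" "D = set x" "End # v = map Sym y @ [End]"
      "derivable (x @ y)"
      by (rule form_ScanD)
    \<comment> \<open>\<open>End\<close> directly behind the head means that everything was scanned;
      \<open>D\<close> is then the full set of letters, as the context test requires.\<close>
    then have "y = [] \<and> v = []" by (cases y) auto
    then show ?thesis using w scan_end xy form_Apply[of x "[]" \<rho>] by simp
  next
    case apply_sym
    then obtain x y where xy: "u @ [Sym a] = Busy # map Sym x" "v = map Sym y @ [End]"
      "derivable (x @ y)"
      "\<rho> \<in> rules \<gamma>" "fst (snd \<rho>) \<subseteq> set (x @ y)" "snd (snd \<rho>) \<inter> set (x @ y) = {}"
      using form_ApplyD[of "u @ [Sym a]" \<rho> v] assms(1) w by auto
    then obtain x' where "x = x' @ [a]" "u = Busy # map Sym x'"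
      by (cases x rule: rev_cases) auto
    then show ?thesis using w apply_sym xy form_Apply[of x' "a # y" \<rho>] by simp
  next
    case app
    then obtain x y where xy: "u = Busy # map Sym x"
      "map Sym (lhs (fst \<rho>)) @ v = map Sym y @ [End]" "derivable (x @ y)"
      "\<rho> \<in> rules \<gamma>" "fst (snd \<rho>) \<subseteq> set (x @ y)" "snd (snd \<rho>) \<inter> set (x @ y) = {}"
      using form_ApplyD[of u \<rho> "map Sym (lhs (fst \<rho>)) @ v"] assms(1) w by auto
    obtain y' where y: "y = lhs (fst \<rho>) @ y'" "v = map Sym y' @ [End]"
      using map_Sym_append_End[OF xy(2)] by blast
    have "derivable (x @ rhs (fst \<rho>) @ y')" using xy y derivable_step by simp
    then show ?thesis using w app xy y form_Back[of x "rhs (fst \<rho>) @ y'"] by simp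
  next
    case back_sym
    then obtain x y where xy: "u @ [Sym a] = Busy # map Sym x" "v = map Sym y @ [End]"
      "derivable (x @ y)"
      using form_BackD[of "u @ [Sym a]" v] assms(1) w by auto
    then obtain x' where "x = x' @ [a]" "u = Busy # map Sym x'"
      by (cases x rule: rev_cases) auto
    then show ?thesis using w back_sym xy form_Back[of x' "a # y"] by simp
  next
    case emit_sym
    then obtain x y where xy: "u = map Sym x" "map Sym [a] @ v = map Sym y @ [End]"
      "derivable (x @ y)"
      using form_EmitD[of u "Sym a # v"] assms(1) w by auto
    obtain y' where "y = [a] @ y'" "v = map Sym y' @ [End]" using map_Sym_append_End[OF xy(2)] by blast
    then show ?thesis using w emit_sym xy form_Emit[of "x @ [a]" y'] by simp
  qed
qed

lemma form_star: "(grammar_step G)\<^sup>*\<^sup>* [Start] w \<Longrightarrow> form w"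
  by (induction rule: rtranclp_induct) (auto intro: form_Start form_step)

section \<open>Simulating one step by one round trip of the head\<close>

lemma grammar_stepI: "(l, r) \<in> scan_productions \<gamma> \<Longrightarrow> grammar_step G (u @ l @ v) (u @ r @ v)"
  by (auto simp: grammar_step_def)

lemma scan_star:
  "x \<in> lists V \<Longrightarrow> y \<in> lists V \<Longrightarrow>
    (grammar_step G)\<^sup>*\<^sup>* (Busy # map Sym x @ Scan (set x) # map Sym y @ [End])
      (Busy # map Sym (x @ y) @ [Scan (set (x @ y)), End])"
proof (induction y arbitrary: x)
  case (Cons a y)
  have "([Scan (set x), Sym a], [Sym a, Scan (insert a (set x))]) \<in> scan_productions \<gamma>"
    using Cons.prems by (auto simp: scan_productions_def)
  from grammar_stepI[OF this, of "Busy # map Sym x" "map Sym y @ [End]"]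
  have "grammar_step G (Busy # map Sym x @ Scan (set x) # map Sym (a # y) @ [End])
      (Busy # map Sym (x @ [a]) @ Scan (set (x @ [a])) # map Sym y @ [End])" by simp
  also have "(grammar_step G)\<^sup>*\<^sup>* \<dots> (Busy # map Sym (x @ a # y) @ [Scan (set (x @ a # y)), End])"
    using Cons.IH[of "x @ [a]"] Cons.prems by simp
  finally show ?case .
qed simp

text \<open>The head \<open>h\<close> is left open because the same walk serves
  \<open>Apply \<rho>\<close> on its way to the place of application and \<open>Back\<close> on its
  return.\<close>

lemma left_star:
  assumes "\<And>a. a \<in> V \<Longrightarrow> ([Sym a, h], [h, Sym a]) \<in> scan_productions \<gamma>"
  shows "y \<in> lists V \<Longrightarrow> (grammar_step G)\<^sup>*\<^sup>* (u @ map Sym y @ h # v) (u @ h # map Sym y @ v)"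
proof (induction y arbitrary: v rule: rev_induct)
  case (snoc a y)
  then have "grammar_step G (u @ map Sym (y @ [a]) @ h # v) (u @ map Sym y @ h # Sym a # v)"
    using grammar_stepI[OF assms[of a], of "u @ map Sym y" v] by simp
  also have "(grammar_step G)\<^sup>*\<^sup>* \<dots> (u @ h # map Sym y @ Sym a # v)"
    using snoc by simp
  finally show ?case by simp
qed simp

lemma emit_star:
  "y \<in> lists (terminals \<gamma>) \<Longrightarrow>
    (grammar_step G)\<^sup>*\<^sup>* (map Sym x @ Emit # map Sym y @ [End]) (map Sym (x @ y))"
proof (induction y arbitrary: x)
  case Nil
  have "([Emit, End], []) \<in> scan_productions \<gamma>" by (simp add: scan_productions_def)
  from grammar_stepI[OF this, of "map Sym x" "[]"] show ?case by auto
next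
  case (Cons a y)
  have "([Emit, Sym a], [Sym a, Emit]) \<in> scan_productions \<gamma>"
    using Cons.prems by (auto simp: scan_productions_def)
  from grammar_stepI[OF this, of "map Sym x" "map Sym y @ [End]"]
  have "grammar_step G (map Sym x @ Emit # map Sym (a # y) @ [End])
      (map Sym (x @ [a]) @ Emit # map Sym y @ [End])" by simp
  also have "(grammar_step G)\<^sup>*\<^sup>* \<dots> (map Sym (x @ a # y))"
    using Cons.IH[of "x @ [a]"] Cons.prems by simp
  finally show ?case .
qed

lemma rc_step_simulated:
  assumes w: "w \<in> lists V" and st: "rc_step \<gamma> w w'"
  shows "w' \<in> lists V \<and>
    (grammar_step G)\<^sup>*\<^sup>* (Idle # map Sym w @ [End]) (Idle # map Sym w' @ [End])"
proof -
  obtain \<rho> where \<rho>: "\<rho> \<in> rules \<gamma>" "rc_rule_step \<rho> w w'" using st by (auto simp: rc_step_def)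
  then have cond: "fst (snd \<rho>) \<subseteq> set w" "snd (snd \<rho>) \<inter> set w = {}" "insdel_step (fst \<rho>) w w'"
    by (cases \<rho>; simp)+
  then obtain x y where xy: "w = x @ lhs (fst \<rho>) @ y" "w' = x @ rhs (fst \<rho>) @ y"
    by (auto simp: insdel_step_iff)
  have w': "w' \<in> lists V" using w xy rhs_over[OF rule_over_fst[OF \<rho>(1)]] by auto
  have "grammar_step G (Idle # map Sym w @ [End]) (Busy # Scan {} # map Sym w @ [End])"
    using grammar_stepI[of "[Idle]" "[Busy, Scan {}]" "[]" "map Sym w @ [End]"]
    by (simp add: scan_productions_def)
  also have "(grammar_step G)\<^sup>*\<^sup>* \<dots> (Busy # map Sym w @ [Scan (set w), End])"
    using scan_star[of "[]" w] w by simp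
  also have "grammar_step G \<dots> (Busy # map Sym w @ [Apply \<rho>, End])"
  proof -
    have "([Scan (set w), End], [Apply \<rho>, End]) \<in> scan_productions \<gamma>"
      using \<rho>(1) cond w unfolding scan_productions_def by (force simp: lists_eq_set)
    from grammar_stepI[OF this, of "Busy # map Sym w" "[]"] show ?thesis by simp
  qed
  also have "(grammar_step G)\<^sup>*\<^sup>* \<dots>
      (Busy # map Sym x @ Apply \<rho> # map Sym (lhs (fst \<rho>) @ y) @ [End])"
  proof -
    have "([Sym a, Apply \<rho>], [Apply \<rho>, Sym a]) \<in> scan_productions \<gamma>" if "a \<in> V" for a
      using that \<rho>(1) unfolding scan_productions_def by force
    from left_star[OF this, of "lhs (fst \<rho>) @ y" "Busy # map Sym x" "[End]"]
    show ?thesis using w unfolding xy by simp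
  qed
  also have "grammar_step G \<dots> (Busy # map Sym x @ Back # map Sym (rhs (fst \<rho>) @ y) @ [End])"
  proof -
    have "(Apply \<rho> # map Sym (lhs (fst \<rho>)), Back # map Sym (rhs (fst \<rho>))) \<in> scan_productions \<gamma>"
      using \<rho>(1) unfolding scan_productions_def by blast
    from grammar_stepI[OF this, of "Busy # map Sym x" "map Sym y @ [End]"] show ?thesis by simp
  qed
  also have "(grammar_step G)\<^sup>*\<^sup>* \<dots> (Busy # Back # map Sym w' @ [End])"
  proof -
    have "([Sym a, Back], [Back, Sym a]) \<in> scan_productions \<gamma>" if "a \<in> V" for a
      using that unfolding scan_productions_def by force
    from left_star[OF this, of x "[Busy]" "map Sym (rhs (fst \<rho>) @ y) @ [End]"]
    show ?thesis using w unfolding xy by simp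
  qed
  also have "grammar_step G \<dots> (Idle # map Sym w' @ [End])"
    using grammar_stepI[of "[Busy, Back]" "[Idle]" "[]" "map Sym w' @ [End]"]
    by (simp add: scan_productions_def)
  finally show ?thesis using w' by simp
qed

lemma derivable_simulated:
  assumes "derivable w"
  shows "(grammar_step G)\<^sup>*\<^sup>* [Start] (Idle # map Sym w @ [End])"
proof -
  obtain x where x: "x \<in> initials \<gamma>" "(rc_step \<gamma>)\<^sup>*\<^sup>* x w" using assms by (auto simp: derivable_def)
  from x(2) have "w \<in> lists V \<and> (grammar_step G)\<^sup>*\<^sup>* (Idle # map Sym x @ [End]) (Idle # map Sym w @ [End])"
  proof (induction rule: rtranclp_induct)
    case base
    then show ?case using x(1) rc by (auto simp: rc_system_def)
  next
    case (step y z)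
    then show ?case using rc_step_simulated[of y z] by (meson rtranclp_trans)
  qed
  moreover have "grammar_step G [Start] (Idle # map Sym x @ [End])"
    using grammar_stepI[of "[Start]" "Idle # map Sym x @ [End]" "[]" "[]"] x(1)
    by (simp add: scan_productions_def)
  ultimately show ?thesis by (meson converse_rtranclp_into_rtranclp)
qed

lemma scan_grammar_language: "grammar_language G = map Sym ` rc_language \<gamma>"
proof (intro set_eqI iffI)
  fix w assume "w \<in> grammar_language G"
  then have w: "w \<in> lists (Sym ` terminals \<gamma>)" "form w"
    by (simp_all add: grammar_language_def form_star)
  \<comment> \<open>Every case of \<open>form\<close> other than \<open>form_done\<close> contains
    one of these two symbols.\<close>
  have "Start \<notin> set w" "End \<notin> set w" using w(1) by auto
  with w(2) obtain x where "w = map Sym x" "derivable x" by (cases rule: form.cases) auto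
  moreover from this w(1) have "x \<in> lists (terminals \<gamma>)" by (auto simp: lists_eq_set)
  ultimately show "w \<in> map Sym ` rc_language \<gamma>"
    unfolding rc_language_def derivable_def by blast
next
  fix w assume "w \<in> map Sym ` rc_language \<gamma>"
  then obtain x where x: "w = map Sym x" "x \<in> lists (terminals \<gamma>)" "derivable x"
    by (auto simp: rc_language_def derivable_def)
  have "(grammar_step G)\<^sup>*\<^sup>* [Start] (Idle # map Sym x @ [End])" using derivable_simulated x(3) .
  also have "grammar_step G \<dots> (Emit # map Sym x @ [End])"
    using grammar_stepI[of "[Idle]" "[Emit]" "[]" "map Sym x @ [End]"]
    by (simp add: scan_productions_def)
  also have "(grammar_step G)\<^sup>*\<^sup>* \<dots> (map Sym x)" using emit_star[of x "[]"] x(2) by simp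
  finally show "w \<in> grammar_language G"
    using x by (auto simp: grammar_language_def)
qed

end

lemma rc_language_RE:
  fixes \<gamma> :: "'a::infinite rc_system"
  assumes rc: "rc_system \<gamma>"
  shows "rc_language \<gamma> \<in> RE"
proof -
  interpret rc_to_grammar \<gamma> using rc by unfold_locales
  let ?X = "nonterminal_symbols G \<union> terminal_symbols G"
  have "inj (Sym :: 'a \<Rightarrow> 'a scan_symbol)" by (simp add: inj_def)
  moreover have "finite ?X" using type0_scan_grammar by (simp add: type0_grammar_def)
  moreover have "finite V" using rc by (simp add: rc_system_def)
  moreover have "?X \<inter> range Sym \<subseteq> Sym ` V"
    using rc by (auto simp: scan_grammar_def rc_system_def)
  ultimately obtain f :: "'a scan_symbol \<Rightarrow> 'a" where f: "inj_on f ?X" "\<And>a. f (Sym a) = a"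
    using fresh_embedding by metis
  have "grammar_language (rename_grammar f G) = map f ` map Sym ` rc_language \<gamma>"
    using grammar_language_rename[OF type0_scan_grammar f(1)] scan_grammar_language by simp
  also have "\<dots> = rc_language \<gamma>" using f(2) by (simp add: image_comp comp_def)
  finally show ?thesis
    using type0_rename_grammar[OF type0_scan_grammar f(1)] unfolding RE_def by blast
qed

section \<open>Simulation of type-0 grammars by random context systems\<close>

text \<open>\<open>Head p i\<close> marks the place where production \<open>p\<close> is being applied, \<open>i\<close> operations of \<open>ops p\<close>
  having been executed; \<open>Rest\<close> is present between two applications.\<close>

datatype 'a head_symbol =
    Letter 'a | Sep | Rest | Head "'a list \<times> 'a list" nat | Link | Probe | Target

datatype 'a op = Eat (op_symbol: "'a head_symbol") | Put (op_symbol: "'a head_symbol")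

datatype 'a phase =
    Final | Resting | Starting "'a list \<times> 'a list" | Ending "'a list \<times> 'a list"
  | At "'a list \<times> 'a list" nat | Linked "'a list \<times> 'a list" nat | Double "'a list \<times> 'a list" nat
  | Probing "'a list \<times> 'a list" nat | Moved "'a list \<times> 'a list" nat
  | Eating "'a list \<times> 'a list" nat

section \<open>The code of a word\<close>

definition enc :: "'a list \<Rightarrow> 'a head_symbol list" where
  "enc u = concat (map (\<lambda>a. [Letter a, Sep]) u)"

lemma enc_simps [simp]:
  "enc [] = []" "enc (a # u) = Letter a # Sep # enc u" "enc (u @ v) = enc u @ enc v"
  by (simp_all add: enc_def)

text \<open>This is the purpose of \<open>Sep\<close>: a deletion with a fixed left context cannot fire twice in a row.\<close>

lemma enc_no_double: "enc u \<noteq> x @ c # c # z"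
proof (induction u arbitrary: x)
  case (Cons a u)
  show ?case
  proof (cases x)
    case (Cons b x')
    show ?thesis
    proof (cases x')
      case Nil
      then show ?thesis using Cons by (cases u) auto
    next
      case (Cons b' x'')
      then show ?thesis using \<open>x = b # x'\<close> \<open>\<And>x. enc u \<noteq> x @ c # c # z\<close> by simp
    qed
  qed auto
qed simp

lemma enc_eq_append_enc: "enc l @ y = enc u \<Longrightarrow> \<exists>v. u = l @ v \<and> y = enc v"
proof (induction l arbitrary: u)
  case (Cons a l)
  then show ?case by (cases u) auto
qed auto

text \<open>\<open>Letter\<close> and \<open>Sep\<close> alternate, so an occurrence of a nonempty
  code begins at the code of a letter. For empty \<open>l\<close> the cut could separate a letter
  from its \<open>Sep\<close>.\<close>

lemma enc_split:
  "x @ enc l @ y = enc u \<Longrightarrow> l \<noteq> [] \<Longrightarrow> \<exists>v w. u = v @ l @ w \<and> x = enc v \<and> y = enc w"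
proof (induction u arbitrary: x)
  case Nil
  then show ?case by (cases l) auto
next
  case (Cons a u)
  show ?case
  proof (cases x)
    case Nil
    then obtain w where "a # u = l @ w" "y = enc w"
      using Cons.prems enc_eq_append_enc[of l y "a # u"] by auto
    then show ?thesis using Nil by (intro exI[of _ "[]"] exI[of _ w]) simp
  next
    case x: (Cons b x')
    show ?thesis
    proof (cases x')
      case Nil
      then show ?thesis using Cons.prems x by (cases l) auto
    next
      case (Cons s x'')
      then have eq: "x'' @ enc l @ y = enc u" "x = Letter a # Sep # x''" using Cons.prems x by auto
      obtain v w where "u = v @ l @ w" "x'' = enc v" "y = enc w" using Cons.IH[OF eq(1)] Cons.prems by blast
      then show ?thesis using eq(2) by (intro exI[of _ "a # v"] exI[of _ w]) simp
    qed
  qed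
qed

lemma filter_enc: "filter (\<lambda>s. s \<noteq> Sep) (enc u) = map Letter u"
  by (induction u) auto

text \<open>Weaker than being a code, since a marker may be inserted between a letter and its
  \<open>Sep\<close>: the pieces remain plain although they are not codes.\<close>

definition plain :: "'a head_symbol list \<Rightarrow> bool" where
  "plain w \<longleftrightarrow> set w \<subseteq> insert Sep (range Letter)"

lemma plain_simps [simp]:
  "plain []" "plain (s # w) \<longleftrightarrow> s \<in> insert Sep (range Letter) \<and> plain w"
  "plain (v @ w) \<longleftrightarrow> plain v \<and> plain w"
  by (auto simp: plain_def)

lemma plain_enc: "plain (enc u)"
  by (induction u) auto

lemma plainD:
  "plain w \<Longrightarrow> Rest \<notin> set w" "plain w \<Longrightarrow> Head p i \<notin> set w" "plain w \<Longrightarrow> Link \<notin> set w"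
  "plain w \<Longrightarrow> Probe \<notin> set w" "plain w \<Longrightarrow> Target \<notin> set w"
  by (auto simp: plain_def)

lemma plain_filter:
  "plain w \<Longrightarrow> h \<notin> insert Sep (range Letter) \<Longrightarrow> filter (\<lambda>s. s \<noteq> h) w = w"
  by (auto simp: plain_def filter_id_conv)

lemma plain_count: "plain w \<Longrightarrow> h \<notin> insert Sep (range Letter) \<Longrightarrow> count_list w h = 0"
  by (auto simp: plain_def count_list_0_iff)

text \<open>When the marker deleted is unique, the outcome is \<open>filter\<close>, which requires
  no knowledge of its position.\<close>

lemma delete_unique:
  assumes "count_list (u @ h # v) h = 1"
  shows "u @ v = filter (\<lambda>s. s \<noteq> h) (u @ h # v)"
proof -
  have "h \<notin> set u" "h \<notin> set v" using assms by (simp_all add: count_list_0_iff)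
  then have "filter (\<lambda>s. s \<noteq> h) u = u" "filter (\<lambda>s. s \<noteq> h) v = v"
    by (auto simp: filter_id_conv)
  then show ?thesis by simp
qed

text \<open>New symbols appear immediately to the right of the head, hence the reversal.\<close>

definition ops :: "'a list \<times> 'a list \<Rightarrow> 'a op list" where
  "ops p = map Eat (enc (fst p)) @ map Put (rev (enc (snd p)))"

text \<open>The second half of the inserted pair. Deleting \<open>Probe\<close> behind the head
  leaves a put symbol next to the head; deleting it behind a copy of the symbol to be eaten leaves
  \<open>Target\<close> next to that copy.\<close>

definition partner :: "'a list \<times> 'a list \<Rightarrow> nat \<Rightarrow> 'a head_symbol" where
  "partner p i = (case ops p ! i of Eat c \<Rightarrow> Target | Put c \<Rightarrow> c)"

lemma ops_Eat:
  assumes "i < length (ops p)" "ops p ! i = Eat c"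
  shows "i < length (enc (fst p)) \<and> c = enc (fst p) ! i"
  using assms by (auto simp: ops_def nth_append split: if_splits)

text \<open>Putting proceeds from right to left. Behind the head stand the last
  \<open>i - length (enc (fst p))\<close> symbols of the code of the right side, and the operation
  supplies the symbol just before them.\<close>

lemma ops_Put:
  assumes "i < length (ops p)" "ops p ! i = Put c"
  shows "length (enc (fst p)) \<le> i \<and>
    drop (length (ops p) - Suc i) (enc (snd p)) = c # drop (length (ops p) - i) (enc (snd p))"
proof -
  let ?e = "enc (fst p)" and ?r = "enc (snd p)"
  have i: "length ?e \<le> i" "c = rev ?r ! (i - length ?e)" "i < length ?e + length ?r"
    using assms by (auto simp: ops_def nth_append split: if_splits)
  have len: "length (ops p) - Suc i = length ?r - Suc (i - length ?e)"
    "length (ops p) - i = Suc (length (ops p) - Suc i)"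
    using i by (auto simp: ops_def)
  moreover have "c = ?r ! (length ?r - Suc (i - length ?e))"
    using i by (simp add: rev_nth)
  moreover have "length ?r - Suc (i - length ?e) < length ?r" using i by simp
  ultimately show ?thesis using i(1) Cons_nth_drop_Suc by metis
qed

lemma plain_op_symbol: "i < length (ops p) \<Longrightarrow> plain [op_symbol (ops p ! i)]"
proof -
  assume "i < length (ops p)"
  then have "ops p ! i \<in> set (ops p)" by simp
  then show ?thesis
    using plain_enc[of "fst p"] plain_enc[of "snd p"] by (auto simp: ops_def plain_def)
qed

locale grammar_to_rc =
  fixes G :: "'a grammar"
  assumes type0: "type0_grammar G"
begin

lemma lhs_nonempty: "p \<in> productions G \<Longrightarrow> fst p \<noteq> []"
  using type0 by (fastforce simp: type0_grammar_def)

text \<open>Keeps \<open>Starting p\<close> and \<open>Ending p\<close> apart, whose auxiliary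
  symbols would both be \<open>Rest\<close> and \<open>Head p 0\<close> if there were no
  operation.\<close>

lemma ops_pos: "p \<in> productions G \<Longrightarrow> 0 < length (ops p)"
  using lhs_nonempty[of p] by (cases "fst p") (auto simp: ops_def)

definition reachable :: "'a list \<Rightarrow> bool" where
  "reachable u \<longleftrightarrow> (grammar_step G)\<^sup>*\<^sup>* [start_symbol G] u"

definition coded :: "'a head_symbol list \<Rightarrow> bool" where
  "coded w \<longleftrightarrow> (\<exists>u. reachable u \<and> w = enc u)"

text \<open>\<open>x\<close> and \<open>y\<close> are the parts of the word left and right of \<open>Head p i\<close>. While symbols are eaten, the
  \<open>drop\<close> is empty because its count is at least the length of the list; while symbols are put,
  the \<open>take\<close> is the whole list.\<close>

definition cfg :: "'a list \<times> 'a list \<Rightarrow> nat \<Rightarrow> 'a head_symbol list \<Rightarrow> 'a head_symbol list \<Rightarrow> bool"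
  where "cfg p i x y \<longleftrightarrow> (\<exists>y'. y = drop (length (ops p) - i) (enc (snd p)) @ y' \<and>
    coded (x @ take i (enc (fst p)) @ y'))"

lemma coded_plain: "coded w \<Longrightarrow> plain w"
  by (auto simp: coded_def plain_enc)

lemma plain_drop: "plain w \<Longrightarrow> plain (drop n w)"
  using set_drop_subset[of n w] by (auto simp: plain_def)

lemma cfg_plain: "cfg p i x y \<Longrightarrow> plain x \<and> plain y"
  unfolding cfg_def by (auto simp: plain_drop plain_enc dest: coded_plain)

lemma cfg_start: "coded (x @ y) \<Longrightarrow> cfg p 0 x y"
  by (auto simp: cfg_def ops_def)

text \<open>The eaten symbol passes from the word to the recorded prefix
  \<open>take (Suc i)\<close>, so the sentential form that the configuration stands for stays the
  same.\<close>

lemma cfg_Eat: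
  assumes "i < length (ops p)" "ops p ! i = Eat c" "cfg p i x (c # y)"
  shows "cfg p (Suc i) x y"
proof -
  have i: "i < length (enc (fst p))" "c = enc (fst p) ! i" using ops_Eat[OF assms(1,2)] by auto
  then have "drop (length (ops p) - i) (enc (snd p)) = []"
    "drop (length (ops p) - Suc i) (enc (snd p)) = []" by (auto simp: ops_def)
  then show ?thesis using assms(3) i by (auto simp: cfg_def take_Suc_conv_app_nth)
qed

lemma cfg_Eat_no_double:
  assumes "i < length (ops p)" "ops p ! i = Eat c"
  shows "\<not> cfg p i x (c # c # y)"
proof
  assume cfg: "cfg p i x (c # c # y)"
  have "i < length (enc (fst p))" using ops_Eat[OF assms] by auto
  then have "drop (length (ops p) - i) (enc (snd p)) = []" by (auto simp: ops_def)
  with cfg have "coded ((x @ take i (enc (fst p))) @ c # c # y)" by (simp add: cfg_def)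
  then show False unfolding coded_def using enc_no_double by metis
qed

lemma cfg_Put:
  assumes "i < length (ops p)" "ops p ! i = Put c" "cfg p i x y"
  shows "cfg p (Suc i) x (c # y)"
  using ops_Put[OF assms(1,2)] assms(3) by (auto simp: cfg_def)

text \<open>Now the whole code of \<open>fst p\<close> is recorded and that of \<open>snd p\<close>
  stands in the word. \<open>enc_split\<close> aligns the recorded code with the letters of the old
  sentential form, which yields a genuine derivation step. Wherever the head was inserted, eating a
  full left side thus vouches for its place.\<close>

lemma cfg_end:
  assumes p: "p \<in> productions G" and "cfg p (length (ops p)) x y"
  shows "coded (x @ y)"
proof -
  obtain z where z: "y = enc (snd p) @ z" "coded (x @ enc (fst p) @ z)"
    using assms(2) by (auto simp: cfg_def ops_def)
  then obtain u where u: "reachable u" "x @ enc (fst p) @ z = enc u" by (auto simp: coded_def)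
  then obtain v w where vw: "u = v @ fst p @ w" "x = enc v" "z = enc w"
    using enc_split lhs_nonempty[OF p] by blast
  have "grammar_step G u (v @ snd p @ w)"
    using p vw unfolding grammar_step_def by (auto simp: case_prod_beta)
  then have "reachable (v @ snd p @ w)"
    using u(1) by (auto simp: reachable_def)
  then show ?thesis unfolding coded_def using z vw by (intro exI[of _ "v @ snd p @ w"]) simp
qed

text \<open>The permitting and forbidding sets of a rule prescribe exactly which auxiliary symbols occur,
  so the words to which a rule of the system applies determine the phase.\<close>

fun aux_of :: "'a phase \<Rightarrow> 'a head_symbol set" where
  "aux_of Final = {}"
| "aux_of Resting = {Rest}"
| "aux_of (Starting p) = {Rest, Head p 0}"
| "aux_of (Ending p) = {Rest, Head p (length (ops p))}"
| "aux_of (At p i) = {Head p i}"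
| "aux_of (Linked p i) = {Head p i, Head p (Suc i), Link}"
| "aux_of (Double p i) = {Head p i, Head p (Suc i)}"
| "aux_of (Probing p i) = {Head p i, Head p (Suc i), Probe} \<union> ({partner p i} \<inter> {Target})"
| "aux_of (Moved p i) = {Head p (Suc i), Probe} \<union> ({partner p i} \<inter> {Target})"
| "aux_of (Eating p i) = {Head p (Suc i), Target}"

fun valid :: "'a phase \<Rightarrow> bool" where
  "valid Final \<longleftrightarrow> True"
| "valid Resting \<longleftrightarrow> True"
| "valid (Starting p) \<longleftrightarrow> p \<in> productions G"
| "valid (Ending p) \<longleftrightarrow> p \<in> productions G"
| "valid (At p i) \<longleftrightarrow> p \<in> productions G \<and> i \<le> length (ops p)"
| "valid (Linked p i) \<longleftrightarrow> p \<in> productions G \<and> i < length (ops p)"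
| "valid (Double p i) \<longleftrightarrow> p \<in> productions G \<and> i < length (ops p)"
| "valid (Probing p i) \<longleftrightarrow> p \<in> productions G \<and> i < length (ops p)"
| "valid (Moved p i) \<longleftrightarrow> p \<in> productions G \<and> i < length (ops p)"
| "valid (Eating p i) \<longleftrightarrow> p \<in> productions G \<and> i < length (ops p) \<and> is_Eat (ops p ! i)"

text \<open>The state of the control is well defined: \<open>Rest\<close>, \<open>Link\<close>,
  \<open>Probe\<close>, \<open>Target\<close> and the set of heads separate all valid
  phases.\<close>

lemma aux_of_inj:
  assumes "valid ph" "valid ph'" "aux_of ph = aux_of ph'"
  shows "ph = ph'"
proof -
  define heads :: "'a head_symbol set \<Rightarrow> (('a list \<times> 'a list) \<times> nat) set"
    where "heads A = {(p, i). Head p i \<in> A}" for A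
  define key where "key A = (Rest \<in> A, Link \<in> A, Probe \<in> A, Target \<in> A, heads A)" for A
  have key: "key (aux_of Final) = (False, False, False, False, {})"
    "key (aux_of Resting) = (True, False, False, False, {})"
    "key (aux_of (Starting p)) = (True, False, False, False, {(p, 0)})"
    "key (aux_of (Ending p)) = (True, False, False, False, {(p, length (ops p))})"
    "key (aux_of (At p i)) = (False, False, False, False, {(p, i)})"
    "key (aux_of (Linked p i)) = (False, True, False, False, {(p, i), (p, Suc i)})"
    "key (aux_of (Double p i)) = (False, False, False, False, {(p, i), (p, Suc i)})"
    "key (aux_of (Probing p i)) = (False, False, True, partner p i = Target, {(p, i), (p, Suc i)})"
    "key (aux_of (Moved p i)) = (False, False, True, partner p i = Target, {(p, Suc i)})"
    "key (aux_of (Eating p i)) = (False, False, False, True, {(p, Suc i)})" for p i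
    by (auto simp: key_def heads_def)
  have ne: "p \<in> productions G \<Longrightarrow> ops p \<noteq> []" for p using ops_pos by auto
  \<comment> \<open>Two consecutive indices determine the smaller one, which tells apart the phases
    with two heads.\<close>
  have pairs: "{(p, i), (p, Suc i)} = {(q, j), (q, Suc j)} \<longleftrightarrow> p = q \<and> i = j"
    "{(p, i), (p, Suc i)} = {h} \<longleftrightarrow> False" "{h} = {(p, i), (p, Suc i)} \<longleftrightarrow> False"
    for p q :: "'a list \<times> 'a list" and i j h
    by (auto simp: doubleton_eq_iff)
  have "key (aux_of ph) = key (aux_of ph')" using assms(3) by simp
  then show ?thesis
    using assms(1,2)
    by (cases ph; cases ph'; simp add: key pairs ne del: aux_of.simps)
qed

section \<open>The simulating system\<close>

definition aux :: "'a head_symbol set" where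
  "aux = {Rest, Link, Probe, Target} \<union> (\<Union>p\<in>productions G. Head p ` {..length (ops p)})"

text \<open>The new head is created next to the old one before the latter goes, so the place is not
  lost. Eating contains a self-loop: deleting \<open>c\<close> changes no auxiliary symbol, so the
  control cannot count it, and only \<open>Target\<close> next to the head shows that the intended
  copy is gone.\<close>

definition op_edges :: "'a list \<times> 'a list \<Rightarrow> nat \<Rightarrow> ('a phase \<times> 'a head_symbol insdel_rule \<times> 'a phase) set"
  where "op_edges p i =
    {(At p i, Ins [] [Link, Head p (Suc i)] [], Linked p i),
     (Linked p i, Del [Head p i] [Link] [], Double p i),
     (Double p i, Ins [] [Probe, partner p i] [], Probing p i),
     (Probing p i, Del [] [Head p i] [], Moved p i)} \<union>
    (case ops p ! i of
       Put c \<Rightarrow> {(Moved p i, Del [Head p (Suc i)] [Probe] [], At p (Suc i))}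
     | Eat c \<Rightarrow> {(Moved p i, Del [c] [Probe] [], Eating p i),
         (Eating p i, Del [Head p (Suc i)] [c] [], Eating p i),
         (Eating p i, Del [Head p (Suc i)] [Target] [], At p (Suc i))})"

text \<open>No rule replaces a marker by another, so the new one is inserted before the old one is
  deleted; in \<open>Starting p\<close> and \<open>Ending p\<close> both are present. The position
  of \<open>Rest\<close> carries no information, hence an insertion without context suffices. In
  \<open>Final\<close> no auxiliary symbol is left, and only the separators remain to be
  stripped.\<close>

definition edges :: "('a phase \<times> 'a head_symbol insdel_rule \<times> 'a phase) set" where
  "edges =
    {(Resting, Del [] [Rest] [], Final), (Final, Del [] [Sep] [], Final)} \<union>
    (\<Union>p\<in>productions G.
      {(Resting, Ins [] [Head p 0] [], Starting p),
       (Starting p, Del [] [Rest] [], At p 0),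
       (At p (length (ops p)), Ins [] [Rest] [], Ending p),
       (Ending p, Del [] [Head p (length (ops p))] [], Resting)} \<union>
      (\<Union>i<length (ops p). op_edges p i))"

lemma op_edgesI: "p \<in> productions G \<Longrightarrow> i < length (ops p) \<Longrightarrow> e \<in> op_edges p i \<Longrightarrow> e \<in> edges"
  by (auto simp: edges_def)

definition rc :: "'a head_symbol rc_system" where
  "rc = \<lparr>alphabet = Letter ` (nonterminal_symbols G \<union> terminal_symbols G) \<union> {Sep} \<union> aux,
    terminals = Letter ` terminal_symbols G,
    initials = {Rest # enc [start_symbol G]},
    rules = (\<lambda>(ph, r, ph'). (r, aux_of ph, aux - aux_of ph)) ` edges\<rparr>"

lemma rc_simps:
  "terminals rc = Letter ` terminal_symbols G" "initials rc = {Rest # enc [start_symbol G]}"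
  "rules rc = (\<lambda>(ph, r, ph'). (r, aux_of ph, aux - aux_of ph)) ` edges"
  by (simp_all add: rc_def)

lemma edges_cases:
  assumes "(ph, r, ph') \<in> edges"
  obtains
    (finish) "ph = Resting" "r = Del [] [Rest] []" "ph' = Final"
  | (strip) "ph = Final" "r = Del [] [Sep] []" "ph' = Final"
  | (start) p where "p \<in> productions G" "ph = Resting" "r = Ins [] [Head p 0] []" "ph' = Starting p"
  | (started) p where "p \<in> productions G" "ph = Starting p" "r = Del [] [Rest] []" "ph' = At p 0"
  | (leave) p where "p \<in> productions G" "ph = At p (length (ops p))" "r = Ins [] [Rest] []"
      "ph' = Ending p"
  | (left) p where "p \<in> productions G" "ph = Ending p" "r = Del [] [Head p (length (ops p))] []"
      "ph' = Resting"
  | (link) p i where "p \<in> productions G" "i < length (ops p)" "ph = At p i"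
      "r = Ins [] [Link, Head p (Suc i)] []" "ph' = Linked p i"
  | (double) p i where "p \<in> productions G" "i < length (ops p)" "ph = Linked p i"
      "r = Del [Head p i] [Link] []" "ph' = Double p i"
  | (probe) p i where "p \<in> productions G" "i < length (ops p)" "ph = Double p i"
      "r = Ins [] [Probe, partner p i] []" "ph' = Probing p i"
  | (move) p i where "p \<in> productions G" "i < length (ops p)" "ph = Probing p i"
      "r = Del [] [Head p i] []" "ph' = Moved p i"
  | (put) p i c where "p \<in> productions G" "i < length (ops p)" "ops p ! i = Put c" "ph = Moved p i"
      "r = Del [Head p (Suc i)] [Probe] []" "ph' = At p (Suc i)"
  | (find) p i c where "p \<in> productions G" "i < length (ops p)" "ops p ! i = Eat c" "ph = Moved p i"
      "r = Del [c] [Probe] []" "ph' = Eating p i"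
  | (eat) p i c where "p \<in> productions G" "i < length (ops p)" "ops p ! i = Eat c" "ph = Eating p i"
      "r = Del [Head p (Suc i)] [c] []" "ph' = Eating p i"
  | (eaten) p i c where "p \<in> productions G" "i < length (ops p)" "ops p ! i = Eat c"
      "ph = Eating p i" "r = Del [Head p (Suc i)] [Target] []" "ph' = At p (Suc i)"
proof -
  consider "(ph, r, ph') \<in> {(Resting, Del [] [Rest] [], Final), (Final, Del [] [Sep] [], Final)}"
    | p where "p \<in> productions G" "(ph, r, ph') \<in>
       {(Resting, Ins [] [Head p 0] [], Starting p),
       (Starting p, Del [] [Rest] [], At p 0),
       (At p (length (ops p)), Ins [] [Rest] [], Ending p),
       (Ending p, Del [] [Head p (length (ops p))] [], Resting)}"
    | p i where "p \<in> productions G" "i < length (ops p)" "(ph, r, ph') \<in> op_edges p i"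
    using assms unfolding edges_def by blast
  then show thesis
  proof cases
    case 1
    then show thesis using finish strip by auto
  next
    case (2 p)
    then show thesis using start[of p] started[of p] leave[of p] left[of p] by auto
  next
    case (3 p i)
    show thesis
    proof (cases "ops p ! i")
      case (Eat c)
      with 3 show thesis
        using link[of p i] double[of p i] probe[of p i] move[of p i] find[of p i c] eat[of p i c]
          eaten[of p i c]
        by (auto simp: op_edges_def)
    next
      case (Put c)
      with 3 show thesis
        using link[of p i] double[of p i] probe[of p i] move[of p i] put[of p i c]
        by (auto simp: op_edges_def)
    qed
  qed
qed

lemma edges_valid: "(ph, r, ph') \<in> edges \<Longrightarrow> valid ph \<and> valid ph'"
  by (erule edges_cases) simp_all

lemma aux_simps [simp]:
  "Rest \<in> aux" "Link \<in> aux" "Probe \<in> aux" "Target \<in> aux" "Sep \<notin> aux" "Letter a \<notin> aux"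
  "Head p i \<in> aux \<longleftrightarrow> p \<in> productions G \<and> i \<le> length (ops p)"
  by (auto simp: aux_def)

lemma aux_of_subset: "valid ph \<Longrightarrow> aux_of ph \<subseteq> aux"
  by (cases ph) auto

lemma set_enc_subset: "set u \<subseteq> X \<Longrightarrow> set (enc u) \<subseteq> insert Sep (Letter ` X)"
  by (induction u) auto

lemma op_symbol_alphabet:
  assumes "p \<in> productions G" "i < length (ops p)"
  shows "op_symbol (ops p ! i) \<in> alphabet rc"
proof -
  let ?X = "nonterminal_symbols G \<union> terminal_symbols G"
  have "set (fst p) \<subseteq> ?X" "set (snd p) \<subseteq> ?X"
    using assms(1) type0 by (cases p; fastforce simp: type0_grammar_def)+
  then have "op_symbol q \<in> insert Sep (Letter ` ?X)" if "q \<in> set (ops p)" for q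
    using that set_enc_subset[of "fst p" ?X] set_enc_subset[of "snd p" ?X] by (auto simp: ops_def)
  then show ?thesis using assms(2) nth_mem unfolding rc_def by fastforce
qed

lemma edges_over:
  assumes "(ph, r, ph') \<in> edges"
  shows "rule_over (alphabet rc) r \<and> rule_size 2 0 0 1 1 0 r"
proof -
  have a: "Rest \<in> alphabet rc" "Link \<in> alphabet rc" "Probe \<in> alphabet rc" "Target \<in> alphabet rc"
    "Sep \<in> alphabet rc" "\<And>p i. p \<in> productions G \<Longrightarrow> i \<le> length (ops p) \<Longrightarrow> Head p i \<in> alphabet rc"
    by (auto simp: rc_def aux_def)
  have o: "c \<in> alphabet rc"
    if "p \<in> productions G" "i < length (ops p)" "ops p ! i = Eat c \<or> ops p ! i = Put c" for p i c
    using op_symbol_alphabet[OF that(1,2)] that(3) by auto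
  then have "partner p i \<in> alphabet rc" if "p \<in> productions G" "i < length (ops p)" for p i
    using that a(4) by (auto simp: partner_def split: op.splits)
  with assms a o show ?thesis by (elim edges_cases) auto
qed

lemma rc_system_rc: "rc_system rc"
proof -
  have fin: "finite (productions G)" "finite (nonterminal_symbols G)" "finite (terminal_symbols G)"
    and S: "start_symbol G \<in> nonterminal_symbols G"
    using type0 by (auto simp: type0_grammar_def)
  have "finite (op_edges p i)" for p i by (simp add: op_edges_def split: op.splits)
  then have "finite edges" using fin by (simp add: edges_def)
  moreover have "finite aux" using fin by (simp add: aux_def)
  moreover have "rule_over (alphabet rc) r \<and> P \<subseteq> alphabet rc \<and> Q \<subseteq> alphabet rc"
    if rPQ: "(r, P, Q) \<in> rules rc" for r P Q
  proof -
    obtain ph ph' where e: "(ph, r, ph') \<in> edges" "P = aux_of ph" "Q = aux - aux_of ph"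
      using rPQ unfolding rc_simps by auto
    have "aux \<subseteq> alphabet rc" by (auto simp: rc_def)
    then show ?thesis
      using e edges_over[OF e(1)] edges_valid[OF e(1)] aux_of_subset[of ph] by auto
  qed
  moreover have "terminals rc \<subseteq> alphabet rc" "initials rc \<subseteq> lists (alphabet rc)" "finite (initials rc)"
    using S set_enc_subset[of "[start_symbol G]" "nonterminal_symbols G"] by (auto simp: rc_def)
  moreover have "finite (alphabet rc)" "finite (rules rc)"
    using fin \<open>finite edges\<close> \<open>finite aux\<close> by (simp_all add: rc_def)
  ultimately show ?thesis
    unfolding rc_system_def by blast
qed

lemma rc_size_rc: "rc_size 2 0 0 1 1 0 rc"
  unfolding rc_size_def using edges_over by (fastforce simp: rc_def)

lemma rc_step_iff:
  "rc_step rc w w' \<longleftrightarrow>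
    (\<exists>ph r ph'. (ph, r, ph') \<in> edges \<and> insdel_step r w w' \<and> set w \<inter> aux = aux_of ph)"
proof -
  have "aux_of ph \<subseteq> set w \<and> (aux - aux_of ph) \<inter> set w = {} \<longleftrightarrow> set w \<inter> aux = aux_of ph"
    if "(ph, r, ph') \<in> edges" for ph r ph'
    using aux_of_subset edges_valid[OF that] by blast
  then show ?thesis
    unfolding rc_step_def rc_def by (simp add: case_prod_beta) (metis fst_conv prod.collapse snd_conv)
qed

text \<open>The invariant for \<open>Eating\<close> must also cover the dead ends, in which \<open>Target\<close> can no longer
  become adjacent to the head because it was inserted to its left or too far to its right; it
  therefore only speaks about words in which nothing but copies of the eaten symbol is in between.\<close>

fun shape :: "'a phase \<Rightarrow> 'a head_symbol list \<Rightarrow> bool" where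
  "shape Final w \<longleftrightarrow> (\<exists>u. reachable u \<and> filter (\<lambda>s. s \<noteq> Sep) w = map Letter u)"
| "shape Resting w \<longleftrightarrow> (\<exists>x y. w = x @ Rest # y \<and> coded (x @ y))"
| "shape (Starting p) w \<longleftrightarrow> (\<exists>x y. filter (\<lambda>s. s \<noteq> Rest) w = x @ Head p 0 # y \<and>
     count_list w Rest = 1 \<and> cfg p 0 x y)"
| "shape (Ending p) w \<longleftrightarrow> (\<exists>x y. filter (\<lambda>s. s \<noteq> Head p (length (ops p))) w = x @ Rest # y \<and>
     count_list w (Head p (length (ops p))) = 1 \<and> coded (x @ y))"
| "shape (At p i) w \<longleftrightarrow> (\<exists>x y. w = x @ Head p i # y \<and> cfg p i x y)"
| "shape (Linked p i) w \<longleftrightarrow> (\<exists>a b x y. w = a @ Link # Head p (Suc i) # b \<and>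
     a @ b = x @ Head p i # y \<and> cfg p i x y)"
| "shape (Double p i) w \<longleftrightarrow> (\<exists>x y. w = x @ Head p i # Head p (Suc i) # y \<and> cfg p i x y)"
| "shape (Probing p i) w \<longleftrightarrow> (\<exists>a b x y. w = a @ Probe # partner p i # b \<and>
     a @ b = x @ Head p i # Head p (Suc i) # y \<and> cfg p i x y)"
| "shape (Moved p i) w \<longleftrightarrow> (\<exists>a b x y. w = a @ Probe # partner p i # b \<and>
     a @ b = x @ Head p (Suc i) # y \<and> cfg p i x y)"
| "shape (Eating p i) w \<longleftrightarrow> (\<exists>x z. w = x @ Head p (Suc i) # z \<and> Target \<in> set (x @ z) \<and>
     set (x @ z) \<subseteq> insert Target (insert Sep (range Letter)) \<and>
     (\<forall>j y. z = replicate j (op_symbol (ops p ! i)) @ Target # y \<longrightarrow>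
       j \<le> 1 \<and> cfg p i x (op_symbol (ops p ! i) # y)))"

section \<open>The invariant and its preservation\<close>

lemma plain_aux: "plain w \<Longrightarrow> set w \<inter> aux = {}"
  by (auto simp: plain_def)

text \<open>Explains the term \<open>{partner p i} \<inter> {Target}\<close> in
  \<open>aux_of\<close>: a put symbol is plain and thus invisible to the context conditions.\<close>

lemma partner_aux: "i < length (ops p) \<Longrightarrow> {partner p i} \<inter> aux = {partner p i} \<inter> {Target}"
  using plain_op_symbol[of i p] by (auto simp: partner_def split: op.splits)

lemma set_of_filter_unique:
  assumes "filter (\<lambda>s. s \<noteq> h) w = v" "count_list w h = 1"
  shows "set w = insert h (set v)"
proof -
  have "h \<in> set w" using assms(2) by (metis count_list_0_iff zero_neq_one)
  then show ?thesis using assms(1) by auto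
qed

text \<open>Links the invariant to the control: together with \<open>aux_of_inj\<close>, a word of
  shape \<open>ph\<close> admits only edges that leave \<open>ph\<close>.\<close>

lemma shape_aux:
  assumes sh: "shape ph w" and "valid ph"
  shows "set w \<inter> aux = aux_of ph"
proof -
  note int = Int_Un_distrib2 Int_insert_left plain_aux
  have un: "set a \<union> set b = set v" if "a @ b = v" for a b v :: "'a head_symbol list"
    using that by auto
  show ?thesis
  proof (cases ph)
    case Final
    with sh obtain u where "filter (\<lambda>s. s \<noteq> Sep) w = map Letter u" by auto
    then have "set (filter (\<lambda>s. s \<noteq> Sep) w) \<subseteq> range Letter" by auto
    then have "plain w" by (auto simp: plain_def)
    then show ?thesis using Final plain_aux by simp
  next
    case Resting
    with sh obtain x y where "w = x @ Rest # y" "coded (x @ y)" by auto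
    moreover from this have "plain x" "plain y" using coded_plain by fastforce+
    ultimately show ?thesis using Resting by (simp add: int)
  next
    case (Starting p)
    with sh obtain x y where xy: "filter (\<lambda>s. s \<noteq> Rest) w = x @ Head p 0 # y"
      "count_list w Rest = 1" "cfg p 0 x y" by auto
    from xy(3) have "plain x" "plain y" using cfg_plain by blast+
    then show ?thesis
      using Starting set_of_filter_unique[OF xy(1,2)] assms(2) by (simp add: int)
  next
    case (Ending p)
    with sh obtain x y where xy: "filter (\<lambda>s. s \<noteq> Head p (length (ops p))) w = x @ Rest # y"
      "count_list w (Head p (length (ops p))) = 1" "coded (x @ y)" by auto
    from xy(3) have "plain x" "plain y" using coded_plain by fastforce+
    then show ?thesis
      using Ending set_of_filter_unique[OF xy(1,2)] assms(2) by (simp add: int insert_commute)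
  next
    case (At p i)
    with sh obtain x y where "w = x @ Head p i # y" "cfg p i x y" by auto
    moreover from this have "plain x" "plain y" using cfg_plain by blast+
    ultimately show ?thesis using At assms(2) by (simp add: int)
  next
    case (Linked p i)
    with sh obtain a b x y where w: "w = a @ Link # Head p (Suc i) # b" "a @ b = x @ Head p i # y"
      "cfg p i x y" by auto
    from w(3) have "plain x" "plain y" using cfg_plain by blast+
    moreover have "set w = {Link, Head p (Suc i)} \<union> set (x @ Head p i # y)"
      using un[OF w(2)] w(1) by auto
    ultimately show ?thesis using Linked assms(2) by (simp add: int insert_commute)
  next
    case (Double p i)
    with sh obtain x y where "w = x @ Head p i # Head p (Suc i) # y" "cfg p i x y" by auto
    moreover from this have "plain x" "plain y" using cfg_plain by blast+
    ultimately show ?thesis using Double assms(2) by (simp add: int)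
  next
    case (Probing p i)
    with sh obtain a b x y where w: "w = a @ Probe # partner p i # b"
      "a @ b = x @ Head p i # Head p (Suc i) # y" "cfg p i x y" by auto
    let ?S = "insert Probe (set (x @ Head p i # Head p (Suc i) # y))"
    from w(3) have "plain x" "plain y" using cfg_plain by blast+
    then have S: "?S \<inter> aux = {Head p i, Head p (Suc i), Probe}"
      using Probing assms(2) by (simp add: int insert_commute)
    have "set w = ?S \<union> {partner p i}" using un[OF w(2)] w(1) by auto
    then have "set w \<inter> aux = (?S \<inter> aux) \<union> ({partner p i} \<inter> aux)" by blast
    moreover have "{partner p i} \<inter> aux = {partner p i} \<inter> {Target}"
      using partner_aux Probing assms(2) by simp
    ultimately show ?thesis using S Probing by (simp only: aux_of.simps)
  next
    case (Moved p i)
    with sh obtain a b x y where w: "w = a @ Probe # partner p i # b"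
      "a @ b = x @ Head p (Suc i) # y" "cfg p i x y" by auto
    let ?S = "insert Probe (set (x @ Head p (Suc i) # y))"
    from w(3) have "plain x" "plain y" using cfg_plain by blast+
    then have S: "?S \<inter> aux = {Head p (Suc i), Probe}"
      using Moved assms(2) by (simp add: int insert_commute)
    have "set w = ?S \<union> {partner p i}" using un[OF w(2)] w(1) by auto
    then have "set w \<inter> aux = (?S \<inter> aux) \<union> ({partner p i} \<inter> aux)" by blast
    moreover have "{partner p i} \<inter> aux = {partner p i} \<inter> {Target}"
      using partner_aux Moved assms(2) by simp
    ultimately show ?thesis using S Moved by (simp only: aux_of.simps)
  next
    case (Eating p i)
    with sh obtain x z where w: "w = x @ Head p (Suc i) # z" "Target \<in> set (x @ z)"
      "set (x @ z) \<subseteq> insert Target (insert Sep (range Letter))" by auto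
    then have "set (x @ z) \<inter> aux = {Target}" by auto
    moreover have "set w = insert (Head p (Suc i)) (set (x @ z))" using w(1) by auto
    ultimately show ?thesis using Eating assms(2) by (simp add: Int_insert_left)
  qed
qed

text \<open>A new marker is inserted at an arbitrary cut between \<open>c\<close> and
  \<open>d\<close>, and the old marker \<open>h\<close> lies in an unknown one of the two; filtering
  covers both possibilities at once.\<close>

lemma filter_plain_append:
  assumes "c @ d = x @ h # y" "plain x" "plain y" "h \<notin> insert Sep (range Letter)"
  shows "filter (\<lambda>s. s \<noteq> h) c @ filter (\<lambda>s. s \<noteq> h) d = x @ y"
    "count_list c h + count_list d h = 1"
proof -
  have "filter (\<lambda>s. s \<noteq> h) (c @ d) = x @ y"
    unfolding assms(1) using assms(2-4) by (simp add: plain_filter)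
  then show "filter (\<lambda>s. s \<noteq> h) c @ filter (\<lambda>s. s \<noteq> h) d = x @ y" by simp
  have "count_list (c @ d) h = 1"
    unfolding assms(1) using assms(2-4) by (simp add: plain_count)
  then show "count_list c h + count_list d h = 1" by simp
qed

text \<open>\<open>Target\<close> stands behind some copy of \<open>c\<close>, not necessarily the
  one next to the head. If that copy is right of the head and only copies of \<open>c\<close> lie
  between, it must be the adjacent one; if it is left of the head, the condition in
  \<open>shape\<close> is void.\<close>

lemma shape_find:
  assumes i: "i < length (ops p)" "ops p ! i = Eat c"
    and cfg: "cfg p i x y" and eq: "u @ c # b = x @ Head p (Suc i) # y"
  shows "shape (Eating p i) (u @ c # Target # b)"
proof -
  let ?H = "Head p (Suc i)"
  have pl: "plain x" "plain y" "c \<in> insert Sep (range Letter)"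
    using cfg_plain[OF cfg] plain_op_symbol[OF i(1)] i(2) by auto
  then have c: "c \<noteq> ?H" "c \<noteq> Target" by auto
  have "?H \<in> set (u @ c # b)" using eq by simp
  with c consider "?H \<in> set u" | "?H \<in> set b" by auto
  then show ?thesis
  proof cases
    case 1
    then obtain u1 u2 where u: "u = u1 @ ?H # u2" by (meson split_list)
    have *: "u1 = x \<and> u2 @ c # b = y"
      using append_Cons_unique[of u1 ?H "u2 @ c # b" x y] eq u plainD(2)[OF pl(1)] plainD(2)[OF pl(2)] by auto
    then have pb: "plain u2" "plain b" using pl by auto
    have "j \<le> 1 \<and> cfg p i x (c # y')" if "u2 @ c # Target # b = replicate j c @ Target # y'" for j y'
    proof -
      \<comment> \<open>\<open>Target\<close> occurs once in the word, so its position identifies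
        the run of \<open>j\<close> copies with \<open>u2\<close> followed by the chosen
        \<open>c\<close>. A run longer than one would put two equal neighbours into the
        code.\<close>
      have "Target \<notin> set (replicate j c)" using c by auto
      then have "Target \<notin> set (u2 @ [c])" "Target \<notin> set b" using pb plainD(5) c by auto
      then have eqs: "replicate j c = u2 @ [c]" "y' = b"
        using append_Cons_unique[of "replicate j c" Target y' "u2 @ [c]" b] that by auto
      then obtain k where k: "j = Suc k" by (cases j) auto
      then have "u2 = replicate k c"
        using eqs(1) by (simp add: replicate_append_same[symmetric] del: replicate_append_same)
      moreover have "k = 0"
      proof (rule ccontr)
        assume "k \<noteq> 0"
        then obtain m where "k = Suc m" by (cases k) auto
        with \<open>u2 = replicate k c\<close> have "y = c # c # replicate m c @ b"
          using * by (simp add: replicate_app_Cons_same)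
        then show False using cfg_Eat_no_double[OF i] cfg by simp
      qed
      ultimately show ?thesis using k eqs(2) * cfg by simp
    qed
    moreover have "u @ c # Target # b = x @ ?H # (u2 @ c # Target # b)" using u * by simp
    moreover have "set (x @ u2 @ c # Target # b) \<subseteq> insert Target (insert Sep (range Letter))"
      using pl pb by (auto simp: plain_def)
    ultimately show ?thesis
      unfolding shape.simps i(2) op.sel by (intro exI[of _ x] exI[of _ "u2 @ c # Target # b"]) auto
  next
    case 2
    then obtain b1 b2 where b: "b = b1 @ ?H # b2" by (meson split_list)
    have *: "u @ c # b1 = x \<and> b2 = y"
      using append_Cons_unique[of "u @ c # b1" ?H b2 x y] eq b plainD(2)[OF pl(1)] plainD(2)[OF pl(2)] by auto
    then have pb: "plain u" "plain b1" "plain b2" using pl by auto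
    \<comment> \<open>The part right of the head is plain, whereas \<open>Target\<close> can be
      deleted only directly behind the head: a dead end.\<close>
    have "False" if "b2 = replicate j c @ Target # y'" for j y'
    proof -
      have "Target \<in> set b2" using that by simp
      then show False using pb(3) plainD(5) by blast
    qed
    moreover have "u @ c # Target # b = (u @ c # Target # b1) @ ?H # b2" using b by simp
    moreover have "set ((u @ c # Target # b1) @ b2) \<subseteq> insert Target (insert Sep (range Letter))"
      using pl pb by (auto simp: plain_def)
    ultimately show ?thesis
      unfolding shape.simps i(2) op.sel
      by (intro exI[of _ "u @ c # Target # b1"] exI[of _ b2]) auto
  qed
qed

text \<open>An insertion may happen anywhere, and the new shape merely records some splitting of the
  word there. Deleting a marker that occurs once then has a forced position, and its left context
  pins down the recorded splitting.\<close>

lemma shape_step: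
  assumes e: "(ph, r, ph') \<in> edges" and sh: "shape ph w" and st: "insdel_step r w w'"
  shows "shape ph' w'"
  using e
proof (cases rule: edges_cases)
  case finish
  obtain x y v where v: "w = x @ Rest # y" "reachable v" "x @ y = enc v"
    using sh finish by (auto simp: coded_def)
  obtain a b where w: "w = a @ Rest # b" "w' = a @ b" using st finish by auto
  have "plain (x @ y)" using v(3) plain_enc by metis
  then have "a = x \<and> b = y"
    using append_Cons_unique[of a Rest b x y] plainD(1) v(1) w(1) by auto
  then show ?thesis using v w finish filter_enc by auto
next
  case strip
  then show ?thesis using sh st by auto
next
  case (start p)
  obtain x y where x: "w = x @ Rest # y" "coded (x @ y)" using sh start by auto
  obtain c d where w: "w = c @ d" "w' = c @ Head p 0 # d" using st start by auto
  have "plain x" "plain y" using coded_plain[OF x(2)] by auto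
  then have "filter (\<lambda>s. s \<noteq> Rest) c @ filter (\<lambda>s. s \<noteq> Rest) d = x @ y"
    "count_list c Rest + count_list d Rest = 1"
    using filter_plain_append[of c d x Rest y] w(1) x(1) by auto
  moreover from this x(2)
  have "cfg p 0 (filter (\<lambda>s. s \<noteq> Rest) c) (filter (\<lambda>s. s \<noteq> Rest) d)"
    using cfg_start by metis
  ultimately show ?thesis using w(2) start by auto
next
  case (started p)
  obtain x y where x: "filter (\<lambda>s. s \<noteq> Rest) w = x @ Head p 0 # y" "count_list w Rest = 1" "cfg p 0 x y"
    using sh started by auto
  obtain a b where w: "w = a @ Rest # b" "w' = a @ b" using st started by auto
  then have "w' = filter (\<lambda>s. s \<noteq> Rest) w" using delete_unique x(2) by metis
  then show ?thesis using x started by auto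
next
  case (leave p)
  let ?H = "Head p (length (ops p))"
  obtain x y where x: "w = x @ ?H # y" "cfg p (length (ops p)) x y" using sh leave by auto
  obtain c d where w: "w = c @ d" "w' = c @ Rest # d" using st leave by auto
  have "plain x" "plain y" using cfg_plain[OF x(2)] by auto
  then have "filter (\<lambda>s. s \<noteq> ?H) c @ filter (\<lambda>s. s \<noteq> ?H) d = x @ y"
    "count_list c ?H + count_list d ?H = 1"
    using filter_plain_append[of c d x ?H y] w(1) x(1) by auto
  \<comment> \<open>Here the invariant turns from the old sentential form to the new one.\<close>
  moreover from this have "coded (filter (\<lambda>s. s \<noteq> ?H) c @ filter (\<lambda>s. s \<noteq> ?H) d)"
    using cfg_end[OF leave(1) x(2)] by simp
  moreover have "filter (\<lambda>s. s \<noteq> ?H) w' = filter (\<lambda>s. s \<noteq> ?H) c @ Rest # filter (\<lambda>s. s \<noteq> ?H) d"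
    "count_list w' ?H = count_list c ?H + count_list d ?H"
    using w(2) by simp_all
  ultimately show ?thesis unfolding leave(4) shape.simps by metis
next
  case (left p)
  let ?H = "Head p (length (ops p))"
  obtain x y where x: "filter (\<lambda>s. s \<noteq> ?H) w = x @ Rest # y" "count_list w ?H = 1" "coded (x @ y)"
    using sh left by auto
  obtain a b where w: "w = a @ ?H # b" "w' = a @ b" using st left by auto
  then have "w' = filter (\<lambda>s. s \<noteq> ?H) w" using delete_unique x(2) by metis
  then show ?thesis using x left by auto
next
  case (link p i)
  obtain x y where x: "w = x @ Head p i # y" "cfg p i x y" using sh link by auto
  obtain c d where w: "w = c @ d" "w' = c @ Link # Head p (Suc i) # d" using st link by auto
  show ?thesis unfolding link(5) shape.simps using x w by metis
next
  case (double p i)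
  obtain a b x y where x: "w = a @ Link # Head p (Suc i) # b" "a @ b = x @ Head p i # y" "cfg p i x y"
    using sh double by auto
  obtain u v where w: "w = u @ Head p i # Link # v" "w' = u @ Head p i # v" using st double by auto
  have pl: "plain x" "plain y" using cfg_plain[OF x(3)] by auto
  have "Link \<notin> set (a @ b)" unfolding x(2) using plainD(3)[OF pl(1)] plainD(3)[OF pl(2)] by auto
  \<comment> \<open>The left context of the deletion shows that \<open>a\<close> ends in the old
    head, so the pair was inserted directly behind it.\<close>
  then have 1: "u @ [Head p i] = a \<and> v = Head p (Suc i) # b"
    using append_Cons_unique[of "u @ [Head p i]" Link v a "Head p (Suc i) # b"] x(1) w(1) by auto
  then have "u @ Head p i # b = x @ Head p i # y" using x(2) by auto
  then have "u = x \<and> b = y"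
    using append_Cons_unique[of u "Head p i" b x y] plainD(2)[OF pl(1)] plainD(2)[OF pl(2)] by auto
  then show ?thesis unfolding double(5) shape.simps using w(2) 1 x(3) by auto
next
  case (probe p i)
  obtain x y where x: "w = x @ Head p i # Head p (Suc i) # y" "cfg p i x y" using sh probe by auto
  obtain c d where w: "w = c @ d" "w' = c @ Probe # partner p i # d" using st probe by auto
  show ?thesis unfolding probe(5) shape.simps using x w by metis
next
  case (move p i)
  let ?H = "Head p i" and ?f = "filter (\<lambda>s. s \<noteq> Head p i)"
  obtain a b x y where x: "w = a @ Probe # partner p i # b" "a @ b = x @ ?H # Head p (Suc i) # y"
    "cfg p i x y"
    using sh move by auto
  obtain u v where w: "w = u @ ?H # v" "w' = u @ v" using st move by auto
  have pl: "plain x" "plain y" using cfg_plain[OF x(3)] by auto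
  have q: "partner p i \<noteq> ?H"
    using plain_op_symbol[OF move(2)] by (auto simp: partner_def split: op.splits)
  have "count_list (a @ b) ?H = 1" unfolding x(2) using pl by (simp add: plain_count image_iff)
  then have "count_list w ?H = 1" unfolding x(1) using q by simp
  then have "w' = ?f w" using delete_unique w by metis
  then have "w' = ?f a @ Probe # partner p i # ?f b" unfolding x(1) using q by simp
  moreover have "?f a @ ?f b = x @ Head p (Suc i) # y"
    using arg_cong[OF x(2), of ?f] pl by (simp add: plain_filter image_iff)
  ultimately show ?thesis unfolding move(5) shape.simps using x(3) by metis
next
  case (put p i c)
  let ?H = "Head p (Suc i)"
  have q: "partner p i = c" using put by (simp add: partner_def)
  obtain a b x y where x: "w = a @ Probe # c # b" "a @ b = x @ ?H # y" "cfg p i x y"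
    using sh put q by auto
  obtain u v where w: "w = u @ ?H # Probe # v" "w' = u @ ?H # v" using st put by auto
  have pl: "plain x" "plain y" using cfg_plain[OF x(3)] by auto
  have "c \<noteq> Probe" using plain_op_symbol[OF put(2)] put(3) by auto
  moreover have "Probe \<notin> set (a @ b)" unfolding x(2) using plainD(4)[OF pl(1)] plainD(4)[OF pl(2)] by auto
  ultimately have 1: "u @ [?H] = a \<and> v = c # b"
    using append_Cons_unique[of "u @ [?H]" Probe v a "c # b"] x(1) w(1) by auto
  then have "u @ ?H # b = x @ ?H # y" using x(2) by auto
  then have "u = x \<and> b = y"
    using append_Cons_unique[of u ?H b x y] plainD(2)[OF pl(1)] plainD(2)[OF pl(2)] by auto
  then show ?thesis
    unfolding put(6) shape.simps using w(2) 1 cfg_Put[OF put(2,3) x(3)] by auto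
next
  case (find p i c)
  let ?H = "Head p (Suc i)"
  have q: "partner p i = Target" using find by (simp add: partner_def)
  obtain a b x y where x: "w = a @ Probe # Target # b" "a @ b = x @ ?H # y" "cfg p i x y"
    using sh find q by auto
  obtain u v where w: "w = u @ c # Probe # v" "w' = u @ c # v" using st find by auto
  have pl: "plain x" "plain y" using cfg_plain[OF x(3)] by auto
  have "Probe \<notin> set (a @ b)" unfolding x(2) using plainD(4)[OF pl(1)] plainD(4)[OF pl(2)] by auto
  \<comment> \<open>All that is learnt is that the pair stands behind a copy of \<open>c\<close>;
    which copy it is, is left to \<open>shape_find\<close>.\<close>
  then have 1: "u @ [c] = a \<and> v = Target # b"
    using append_Cons_unique[of "u @ [c]" Probe v a "Target # b"] x(1) w(1) by auto
  then have "u @ c # b = x @ ?H # y" using x(2) by auto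
  then show ?thesis using shape_find[OF find(2,3) x(3)] find(6) w(2) 1 by auto
next
  case (eat p i c)
  let ?H = "Head p (Suc i)"
  obtain x z where x: "w = x @ ?H # z" "Target \<in> set (x @ z)"
    "set (x @ z) \<subseteq> insert Target (insert Sep (range Letter))"
    "\<And>j y. z = replicate j c @ Target # y \<Longrightarrow> j \<le> 1 \<and> cfg p i x (c # y)"
    using sh eat by auto
  obtain u v where w: "w = u @ ?H # c # v" "w' = u @ ?H # v" using st eat by auto
  have c: "c \<noteq> Target" using plain_op_symbol[OF eat(2)] eat(3) by auto
  have 1: "u = x \<and> c # v = z"
    using append_Cons_unique[of u ?H "c # v" x z] x(1,3) w(1) by auto
  \<comment> \<open>Before the deletion the run in front of \<open>Target\<close> was one longer, so
    the old bound applies to \<open>Suc j\<close>. The configuration still lists \<open>c\<close>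
    although it is gone from the word; this is settled when \<open>Target\<close> is
    deleted.\<close>
  have "j \<le> 1 \<and> cfg p i x (c # y)" if "v = replicate j c @ Target # y" for j y
    using x(4)[of "Suc j" y] that 1 by auto
  moreover have "Target \<in> set (x @ v)" "set (x @ v) \<subseteq> insert Target (insert Sep (range Letter))"
    using x(2,3) 1 c by auto
  ultimately show ?thesis
    unfolding eat(6) shape.simps eat(3) op.sel using w(2) 1 by blast
next
  case (eaten p i c)
  let ?H = "Head p (Suc i)"
  obtain x z where x: "w = x @ ?H # z" "set (x @ z) \<subseteq> insert Target (insert Sep (range Letter))"
    "\<And>j y. z = replicate j c @ Target # y \<Longrightarrow> j \<le> 1 \<and> cfg p i x (c # y)"
    using sh eaten by auto
  obtain u v where w: "w = u @ ?H # Target # v" "w' = u @ ?H # v" using st eaten by auto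
  have 1: "u = x \<and> Target # v = z"
    using append_Cons_unique[of u ?H "Target # v" x z] x(1,2) w(1) by auto
  \<comment> \<open>\<open>Target\<close> directly behind the head is the run of length 0. The
    configuration lists the \<open>c\<close> that the word lacks, and \<open>cfg_Eat\<close> can
    record it as eaten.\<close>
  then have "cfg p i x (c # v)" using x(3)[of 0 v] by auto
  then show ?thesis
    unfolding eaten(6) shape.simps using w(2) 1 cfg_Eat[OF eaten(2,3)] by blast
qed

lemma shape_star:
  assumes "(rc_step rc)\<^sup>*\<^sup>* (Rest # enc [start_symbol G]) w"
  shows "\<exists>ph. valid ph \<and> shape ph w"
  using assms
proof (induction rule: rtranclp_induct)
  case base
  have "coded ([] @ enc [start_symbol G])" by (auto simp: coded_def reachable_def)
  then have "shape Resting (Rest # enc [start_symbol G])"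
    unfolding shape.simps by (metis append_Nil)
  then show ?case using valid.simps(2) by blast
next
  case (step w w')
  then obtain ph where ph: "valid ph" "shape ph w" by blast
  obtain ph1 r ph' where e: "(ph1, r, ph') \<in> edges" "insdel_step r w w'" "set w \<inter> aux = aux_of ph1"
    using step.hyps(2) unfolding rc_step_iff by blast
  then have "ph1 = ph" using aux_of_inj[of ph1 ph] shape_aux ph edges_valid by metis
  then show ?case using shape_step[OF e(1) _ e(2)] ph edges_valid[OF e(1)] by blast
qed

text \<open>Terminal words have no auxiliary symbols, which leaves \<open>Final\<close> as the only
  phase; computations caught in a dead end keep such symbols and contribute nothing.\<close>

lemma rc_sound:
  assumes "w \<in> rc_language rc"
  shows "w \<in> map Letter ` grammar_language G"
proof -
  have w: "w \<in> lists (Letter ` terminal_symbols G)" "(rc_step rc)\<^sup>*\<^sup>* (Rest # enc [start_symbol G]) w"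
    using assms by (auto simp: rc_language_def rc_simps)
  obtain ph where ph: "valid ph" "shape ph w" using shape_star[OF w(2)] by blast
  have "set w \<inter> aux = {}" using w(1) by auto
  then have "aux_of ph = aux_of Final" using shape_aux ph by simp
  then have "ph = Final" using aux_of_inj[of ph Final] ph(1) by simp
  then obtain u where u: "reachable u" "filter (\<lambda>s. s \<noteq> Sep) w = map Letter u" using ph by auto
  have "filter (\<lambda>s. s \<noteq> Sep) w = w" using w(1) by (auto simp: filter_id_conv)
  then have "w = map Letter u" using u(2) by simp
  moreover from this w(1) have "u \<in> lists (terminal_symbols G)" by (auto simp: lists_eq_set)
  ultimately show ?thesis using u(1) unfolding grammar_language_def reachable_def by blast
qed

section \<open>Simulating derivations of the grammar\<close>

lemma ins_step: "insdel_step (Ins [] a []) (u @ v) (u @ a @ v)"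
  by auto

lemma del_step: "insdel_step (Del c a []) (u @ c @ a @ v) (u @ c @ v)"
  by auto

lemma rc_stepI:
  assumes "(ph, r, ph') \<in> edges" "insdel_step r w w'" "set w \<inter> aux = aux_of ph"
  shows "rc_step rc w w'"
  using assms unfolding rc_step_iff by blast

lemma set_simps:
  "set (x @ y) \<inter> aux = set x \<inter> aux \<union> (set y \<inter> aux)"
  "set (s # y) \<inter> aux = (if s \<in> aux then insert s (set y \<inter> aux) else set y \<inter> aux)"
  "set [] \<inter> aux = {}"
  by auto

lemma link_steps:
  assumes p: "p \<in> productions G" and i: "i < length (ops p)" and pl: "plain x" "plain y"
  shows "(rc_step rc)\<^sup>*\<^sup>* (x @ Head p i # y) (x @ Head p i # Head p (Suc i) # y)"
proof -
  let ?H = "Head p i" and ?H' = "Head p (Suc i)"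
  note aux = set_simps plain_aux[OF pl(1)] plain_aux[OF pl(2)]
  have "(rc_step rc)\<^sup>*\<^sup>* (x @ ?H # y) (x @ ?H # y)" by simp
  also have "rc_step rc \<dots> (x @ ?H # Link # ?H' # y)"
  proof (rule rc_stepI)
    show "(At p i, Ins [] [Link, ?H'] [], Linked p i) \<in> edges"
      by (rule op_edgesI[OF p i]) (simp add: op_edges_def)
    show "insdel_step (Ins [] [Link, ?H'] []) (x @ ?H # y) (x @ ?H # Link # ?H' # y)"
      using ins_step[of "[Link, ?H']" "x @ [?H]" y] by simp
    show "set (x @ ?H # y) \<inter> aux = aux_of (At p i)"
      unfolding aux using p i by simp
  qed
  also have "rc_step rc \<dots> (x @ ?H # ?H' # y)"
  proof (rule rc_stepI)
    show "(Linked p i, Del [?H] [Link] [], Double p i) \<in> edges"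
      by (rule op_edgesI[OF p i]) (simp add: op_edges_def)
    show "insdel_step (Del [?H] [Link] []) (x @ ?H # Link # ?H' # y) (x @ ?H # ?H' # y)"
      using del_step[of "[?H]" "[Link]" x "?H' # y"] by simp
    show "set (x @ ?H # Link # ?H' # y) \<inter> aux = aux_of (Linked p i)"
      unfolding aux using p i by (simp add: insert_commute)
  qed
  finally show ?thesis .
qed

text \<open>The gap \<open>u\<close> between head and \<open>Probe\<close> is empty for a put
  operation and the single symbol to be removed for an eat operation.\<close>

lemma probe_steps:
  assumes p: "p \<in> productions G" and i: "i < length (ops p)" and pl: "plain x" "plain u" "plain v"
  shows "(rc_step rc)\<^sup>*\<^sup>* (x @ Head p i # u @ v)
    (x @ Head p (Suc i) # u @ Probe # partner p i # v)"
proof -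
  let ?H = "Head p i" and ?H' = "Head p (Suc i)" and ?q = "partner p i"
  note aux = set_simps plain_aux[OF pl(1)] plain_aux[OF pl(2)] plain_aux[OF pl(3)]
  have q: "?q \<in> aux \<longleftrightarrow> ?q = Target" using partner_aux[OF i] by auto
  have "(rc_step rc)\<^sup>*\<^sup>* (x @ ?H # u @ v) (x @ ?H # ?H' # u @ v)"
    using link_steps[OF p i pl(1), of "u @ v"] pl by simp
  also have "rc_step rc \<dots> (x @ ?H # ?H' # u @ Probe # ?q # v)"
  proof (rule rc_stepI)
    show "(Double p i, Ins [] [Probe, ?q] [], Probing p i) \<in> edges"
      by (rule op_edgesI[OF p i]) (simp add: op_edges_def)
    show "insdel_step (Ins [] [Probe, ?q] []) (x @ ?H # ?H' # u @ v) (x @ ?H # ?H' # u @ Probe # ?q # v)"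
      using ins_step[of "[Probe, ?q]" "x @ ?H # ?H' # u" v] by simp
    show "set (x @ ?H # ?H' # u @ v) \<inter> aux = aux_of (Double p i)"
      unfolding aux using p i by simp
  qed
  also have "rc_step rc \<dots> (x @ ?H' # u @ Probe # ?q # v)"
  proof (rule rc_stepI)
    show "(Probing p i, Del [] [?H] [], Moved p i) \<in> edges"
      by (rule op_edgesI[OF p i]) (simp add: op_edges_def)
    show "insdel_step (Del [] [?H] []) (x @ ?H # ?H' # u @ Probe # ?q # v) (x @ ?H' # u @ Probe # ?q # v)"
      using del_step[of "[]" "[?H]" x "?H' # u @ Probe # ?q # v"] by simp
    show "set (x @ ?H # ?H' # u @ Probe # ?q # v) \<inter> aux = aux_of (Probing p i)"
      unfolding aux using p i q by auto
  qed
  finally show ?thesis .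
qed

lemma put_steps:
  assumes p: "p \<in> productions G" and i: "i < length (ops p)" and op: "ops p ! i = Put c"
    and pl: "plain x" "plain y"
  shows "(rc_step rc)\<^sup>*\<^sup>* (x @ Head p i # y) (x @ Head p (Suc i) # c # y)"
proof -
  let ?H' = "Head p (Suc i)"
  have q: "partner p i = c" using op by (simp add: partner_def)
  have c: "plain [c]" using plain_op_symbol[OF i] op by simp
  then have "c \<notin> aux" by auto
  note aux = set_simps plain_aux[OF pl(1)] plain_aux[OF pl(2)]
  have "(rc_step rc)\<^sup>*\<^sup>* (x @ Head p i # y) (x @ ?H' # Probe # c # y)"
    using probe_steps[OF p i pl(1) _ pl(2), of "[]"] q by simp
  also have "rc_step rc \<dots> (x @ ?H' # c # y)"
  proof (rule rc_stepI)
    show "(Moved p i, Del [?H'] [Probe] [], At p (Suc i)) \<in> edges"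
      by (rule op_edgesI[OF p i]) (simp add: op_edges_def op)
    show "insdel_step (Del [?H'] [Probe] []) (x @ ?H' # Probe # c # y) (x @ ?H' # c # y)"
      using del_step[of "[?H']" "[Probe]" x "c # y"] by simp
    show "set (x @ ?H' # Probe # c # y) \<inter> aux = aux_of (Moved p i)"
      unfolding aux using p i q c \<open>c \<notin> aux\<close> by auto
  qed
  finally show ?thesis .
qed

lemma eat_steps:
  assumes p: "p \<in> productions G" and i: "i < length (ops p)" and op: "ops p ! i = Eat c"
    and pl: "plain x" "plain y"
  shows "(rc_step rc)\<^sup>*\<^sup>* (x @ Head p i # c # y) (x @ Head p (Suc i) # y)"
proof -
  let ?H' = "Head p (Suc i)"
  have q: "partner p i = Target" using op by (simp add: partner_def)
  have c: "plain [c]" using plain_op_symbol[OF i] op by simp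
  then have "c \<notin> aux" by auto
  note aux = set_simps plain_aux[OF pl(1)] plain_aux[OF pl(2)]
  have "(rc_step rc)\<^sup>*\<^sup>* (x @ Head p i # c # y) (x @ ?H' # c # Probe # Target # y)"
    using probe_steps[OF p i pl(1) c pl(2)] q by simp
  also have "rc_step rc \<dots> (x @ ?H' # c # Target # y)"
  proof (rule rc_stepI)
    show "(Moved p i, Del [c] [Probe] [], Eating p i) \<in> edges"
      by (rule op_edgesI[OF p i]) (simp add: op_edges_def op)
    show "insdel_step (Del [c] [Probe] []) (x @ ?H' # c # Probe # Target # y) (x @ ?H' # c # Target # y)"
      using del_step[of "[c]" "[Probe]" "x @ [?H']" "Target # y"] by simp
    show "set (x @ ?H' # c # Probe # Target # y) \<inter> aux = aux_of (Moved p i)"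
      unfolding aux using p i q \<open>c \<notin> aux\<close> by auto
  qed
  also have "rc_step rc \<dots> (x @ ?H' # Target # y)"
  proof (rule rc_stepI)
    show "(Eating p i, Del [?H'] [c] [], Eating p i) \<in> edges"
      by (rule op_edgesI[OF p i]) (simp add: op_edges_def op)
    show "insdel_step (Del [?H'] [c] []) (x @ ?H' # c # Target # y) (x @ ?H' # Target # y)"
      using del_step[of "[?H']" "[c]" x "Target # y"] by simp
    show "set (x @ ?H' # c # Target # y) \<inter> aux = aux_of (Eating p i)"
      unfolding aux using p i \<open>c \<notin> aux\<close> by simp
  qed
  also have "rc_step rc \<dots> (x @ ?H' # y)"
  proof (rule rc_stepI)
    show "(Eating p i, Del [?H'] [Target] [], At p (Suc i)) \<in> edges"
      by (rule op_edgesI[OF p i]) (simp add: op_edges_def op)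
    show "insdel_step (Del [?H'] [Target] []) (x @ ?H' # Target # y) (x @ ?H' # y)"
      using del_step[of "[?H']" "[Target]" x y] by simp
    show "set (x @ ?H' # Target # y) \<inter> aux = aux_of (Eating p i)"
      unfolding aux using p i by simp
  qed
  finally show ?thesis .
qed

text \<open>At most one of the two \<open>drop\<close> terms is nonempty: nothing is put before the
  left side has been eaten completely.\<close>

lemma ops_star:
  assumes p: "p \<in> productions G" and pl: "plain x" "plain y"
  shows "i \<le> length (ops p) \<Longrightarrow> (rc_step rc)\<^sup>*\<^sup>* (x @ Head p 0 # enc (fst p) @ y)
    (x @ Head p i # drop (length (ops p) - i) (enc (snd p)) @ drop i (enc (fst p)) @ y)"
proof (induction i)
  case 0
  then show ?case by (simp add: ops_def)
next
  case (Suc i)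
  let ?n = "length (ops p)" and ?e = "enc (fst p)" and ?r = "enc (snd p)"
  have i: "i < ?n" using Suc.prems by simp
  have pl': "plain (drop k (enc u) @ y)" for k u using plain_drop[OF plain_enc] pl(2) by simp
  have "(rc_step rc)\<^sup>*\<^sup>* (x @ Head p i # drop (?n - i) ?r @ drop i ?e @ y)
      (x @ Head p (Suc i) # drop (?n - Suc i) ?r @ drop (Suc i) ?e @ y)"
  proof (cases "ops p ! i")
    case (Eat c)
    have j: "i < length ?e" "c = ?e ! i" using ops_Eat[OF i Eat] by auto
    then have "drop (?n - i) ?r = []" "drop (?n - Suc i) ?r = []" "drop i ?e = c # drop (Suc i) ?e"
      by (auto simp: ops_def Cons_nth_drop_Suc)
    then show ?thesis
      using eat_steps[OF p i Eat pl(1) pl'[of "Suc i" "fst p"]] by simp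
  next
    case (Put c)
    have j: "length ?e \<le> i" "drop (?n - Suc i) ?r = c # drop (?n - i) ?r"
      using ops_Put[OF i Put] by auto
    then show ?thesis
      using put_steps[OF p i Put pl(1) pl'[of "?n - i" "snd p"]] by simp
  qed
  then show ?case using Suc.IH i by (meson less_imp_le_nat rtranclp_trans)
qed

lemma production_star:
  assumes p: "p \<in> productions G"
  shows "(rc_step rc)\<^sup>*\<^sup>* (Rest # enc (x @ fst p @ y)) (Rest # enc (x @ snd p @ y))"
proof -
  let ?x = "enc x" and ?y = "enc y" and ?e = "enc (fst p)" and ?r = "enc (snd p)"
  let ?n = "length (ops p)"
  note aux = set_simps plain_aux[OF plain_enc]
  have "(rc_step rc)\<^sup>*\<^sup>* (Rest # ?x @ ?e @ ?y) (Rest # ?x @ ?e @ ?y)" by simp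
  also have "rc_step rc \<dots> (Rest # ?x @ Head p 0 # ?e @ ?y)"
  proof (rule rc_stepI)
    show "(Resting, Ins [] [Head p 0] [], Starting p) \<in> edges" using p by (auto simp: edges_def)
    show "insdel_step (Ins [] [Head p 0] []) (Rest # ?x @ ?e @ ?y) (Rest # ?x @ Head p 0 # ?e @ ?y)"
      using ins_step[of "[Head p 0]" "Rest # ?x" "?e @ ?y"] by simp
    show "set (Rest # ?x @ ?e @ ?y) \<inter> aux = aux_of Resting" unfolding aux by simp
  qed
  also have "rc_step rc \<dots> (?x @ Head p 0 # ?e @ ?y)"
  proof (rule rc_stepI)
    show "(Starting p, Del [] [Rest] [], At p 0) \<in> edges" using p by (auto simp: edges_def)
    show "insdel_step (Del [] [Rest] []) (Rest # ?x @ Head p 0 # ?e @ ?y) (?x @ Head p 0 # ?e @ ?y)"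
      using del_step[of "[]" "[Rest]" "[]" "?x @ Head p 0 # ?e @ ?y"] by simp
    show "set (Rest # ?x @ Head p 0 # ?e @ ?y) \<inter> aux = aux_of (Starting p)"
      unfolding aux using p by simp
  qed
  also have "(rc_step rc)\<^sup>*\<^sup>* \<dots> (?x @ Head p ?n # ?r @ ?y)"
    using ops_star[OF p plain_enc plain_enc, of ?n x y] by (simp add: ops_def)
  also have "rc_step rc \<dots> (Rest # ?x @ Head p ?n # ?r @ ?y)"
  proof (rule rc_stepI)
    show "(At p ?n, Ins [] [Rest] [], Ending p) \<in> edges" using p by (auto simp: edges_def)
    show "insdel_step (Ins [] [Rest] []) (?x @ Head p ?n # ?r @ ?y) (Rest # ?x @ Head p ?n # ?r @ ?y)"
      using ins_step[of "[Rest]" "[]"] by simp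
    show "set (?x @ Head p ?n # ?r @ ?y) \<inter> aux = aux_of (At p ?n)"
      unfolding aux using p by simp
  qed
  also have "rc_step rc \<dots> (Rest # ?x @ ?r @ ?y)"
  proof (rule rc_stepI)
    show "(Ending p, Del [] [Head p ?n] [], Resting) \<in> edges" using p by (auto simp: edges_def)
    show "insdel_step (Del [] [Head p ?n] []) (Rest # ?x @ Head p ?n # ?r @ ?y) (Rest # ?x @ ?r @ ?y)"
      using del_step[of "[]" "[Head p ?n]" "Rest # ?x" "?r @ ?y"] by simp
    show "set (Rest # ?x @ Head p ?n # ?r @ ?y) \<inter> aux = aux_of (Ending p)"
      unfolding aux using p by simp
  qed
  finally show ?thesis by simp
qed

lemma strip_star:
  "(rc_step rc)\<^sup>*\<^sup>* (map Letter v @ enc u) (map Letter (v @ u))"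
proof (induction u arbitrary: v)
  case (Cons a u)
  let ?v = "map Letter (v @ [a])"
  have pl: "plain ?v" by (auto simp: plain_def)
  have "rc_step rc (?v @ Sep # enc u) (?v @ enc u)"
  proof (rule rc_stepI)
    show "(Final, Del [] [Sep] [], Final) \<in> edges" by (simp add: edges_def)
    show "insdel_step (Del [] [Sep] []) (?v @ Sep # enc u) (?v @ enc u)"
      using del_step[of "[]" "[Sep]" ?v "enc u"] by simp
    show "set (?v @ Sep # enc u) \<inter> aux = aux_of Final"
      using plain_aux[of "?v @ Sep # enc u"] pl plain_enc[of u] by simp
  qed
  also have "(rc_step rc)\<^sup>*\<^sup>* (?v @ enc u) (map Letter (v @ a # u))"
    using Cons.IH[of "v @ [a]"] by simp
  finally show ?case by simp
qed simp

lemma rc_complete: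
  assumes "u \<in> grammar_language G"
  shows "map Letter u \<in> rc_language rc"
proof -
  have u: "u \<in> lists (terminal_symbols G)" "(grammar_step G)\<^sup>*\<^sup>* [start_symbol G] u"
    using assms by (auto simp: grammar_language_def)
  from u(2) have "(rc_step rc)\<^sup>*\<^sup>* (Rest # enc [start_symbol G]) (Rest # enc u)"
  proof (induction rule: rtranclp_induct)
    case (step v w)
    then obtain p x y where p: "p \<in> productions G" "v = x @ fst p @ y" "w = x @ snd p @ y"
      by (auto simp: grammar_step_def)
    have "(rc_step rc)\<^sup>*\<^sup>* (Rest # enc v) (Rest # enc w)"
      using production_star[OF p(1)] unfolding p(2,3) .
    with step.IH show ?case by (rule rtranclp_trans)
  qed simp
  also have "rc_step rc \<dots> (enc u)"
  proof (rule rc_stepI)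
    show "(Resting, Del [] [Rest] [], Final) \<in> edges" by (simp add: edges_def)
    show "insdel_step (Del [] [Rest] []) (Rest # enc u) (enc u)"
      using del_step[of "[]" "[Rest]" "[]" "enc u"] by simp
    show "set (Rest # enc u) \<inter> aux = aux_of Resting"
      unfolding set_simps plain_aux[OF plain_enc] by simp
  qed
  also have "(rc_step rc)\<^sup>*\<^sup>* \<dots> (map Letter u)" using strip_star[of "[]" u] by simp
  finally show ?thesis using u(1) unfolding rc_language_def rc_simps by auto
qed

lemma rc_language_rc: "rc_language rc = map Letter ` grammar_language G"
  using rc_sound rc_complete by blast

end

section \<open>Return to the original symbols and equality of the families\<close>

lemma grammar_language_RC_INS_DEL:
  fixes G :: "'a::infinite grammar"
  assumes "type0_grammar G"
  shows "grammar_language G \<in> RC_INS_DEL 2 0 0 1 1 0"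
proof -
  interpret grammar_to_rc G using assms by unfold_locales
  let ?V = "nonterminal_symbols G \<union> terminal_symbols G"
  have "inj (Letter :: 'a \<Rightarrow> 'a head_symbol)" by (simp add: inj_def)
  moreover have "finite (alphabet rc)" using rc_system_rc by (simp add: rc_system_def)
  moreover have "finite ?V" using assms by (simp add: type0_grammar_def)
  moreover have "alphabet rc \<inter> range Letter \<subseteq> Letter ` ?V" by (auto simp: rc_def)
  ultimately obtain f :: "'a head_symbol \<Rightarrow> 'a" where
    f: "inj_on f (alphabet rc)" "\<And>a. f (Letter a) = a"
    using fresh_embedding by metis
  have "rc_language (rename_rc f rc) = map f ` map Letter ` grammar_language G"
    using rc_language_rename[OF rc_system_rc f(1)] rc_language_rc by simp
  also have "\<dots> = grammar_language G" using f(2) by (simp add: image_comp comp_def)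
  finally show ?thesis
    using rc_system_rename[OF rc_system_rc] rc_size_rename[OF rc_size_rc]
    unfolding RC_INS_DEL_def by blast
qed

theorem theorem3:
  shows "(RC_INS_DEL 2 0 0 1 1 0 :: 'a::infinite list set set) = RE"
proof
  show "(RC_INS_DEL 2 0 0 1 1 0 :: 'a list set set) \<subseteq> RE"
    using rc_language_RE by (auto simp: RC_INS_DEL_def)
  show "(RE :: 'a list set set) \<subseteq> RC_INS_DEL 2 0 0 1 1 0"
    using grammar_language_RC_INS_DEL by (auto simp: RE_def)
qed

end
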